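(* Let $X_t=f_t+\varepsilon_t$, $t=1,\ldots,T$, where $f$ is piecewise constant with $N$ change-points $\eta_1<\cdots<\eta_N$ (i.e. $f_{\eta_i}\ne f_{\eta_i-1}$ and $f$ is constant elsewhere), and suppose: (a) $\varepsilon_t$ are i.i.d. $N(0,\sigma^2)$; (b) with $\eta_0=1$, $\eta_{N+1}=T+1$, $\min_{i=1,\ldots,N+1}(\eta_i-\eta_{i-1})\ge \delta T$ for some fixed $\delta>0$; (c) $|f_t|\le\bar f<\infty$ for all $t$; (d) $\min_{i}|f_{\eta_i}-f_{\eta_i-1}|\ge\underline f_T\ge CT^{\kappa}$ for some $C>0$, $\kappa>-1/2$. Fix $\Delta>0$. Let $(s_k,e_k,b_k,|\tilde X_{s_k,e_k}^{b_k}|)_{k=1}^{T-1}$ be the sorted WBS2 solution path, and let $\tilde\eta_1<\cdots<\tilde\eta_N$ be $b_1,\ldots,b_N$ sorted increasingly. Then there exist positive constants $C_1(\Delta),C_2(\Delta)$ depending only on $\Delta$ (and the model constants) and $c>0$ such that, defining the event $$\mathcal A_T=\Big\{\max_{i=1,\ldots,N}|\eta_i-\tilde\eta_i|\le C_1(\Delta)\underline f_T^{-2}\log T\Big\}\cap\Big\{|\tilde X_{s_k,e_k}^{b_k}|\ge c\,\underline f_T T^{1/2},\ k=1,\ldots,N\Big\}\cap\Big\{|\tilde X_{s_k,e_k}^{b_k}|\le C_2(\Delta)\log^{1/2}T,\ k=N+1,\ldots,T-1\Big\},$$ for all $T$ large enough, $$P(\mathcal A_T)\ge 1-\alpha_T-\tfrac12N(N+1)\big(2C_1(\Delta)\underline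 f_T^{-2}\log T+1\big)^2(1-\delta^2/9)^{\tilde M},$$ where $\alpha_T=1-P(\mathcal B_{\Delta,T})$ and $\mathcal B_{\Delta,T}=\{\forall\,1\le l\le m\le T:\ (m-l+1)^{-1/2}|\sum_{i=l}^m\varepsilon_i|\le\sigma\{2(1+\Delta)\log T\}^{1/2}\}$.
   Context: For $1\le s\le b<e\le T$ and $n=e-s+1$, the CUSUM statistic is $\tilde X_{s,e}^b=\sqrt{\frac{e-b}{n(b-s+1)}}\sum_{t=s}^b X_t-\sqrt{\frac{b-s+1}{n(e-b)}}\sum_{t=b+1}^e X_t$. The recursive routine $\textsc{WBS2.Sol.Path}(s,e,\tilde M)$: if $e-s<1$, stop. If $\tilde M\ge \frac12(e-s+1)(e-s)$, take all intervals $[s_m,e_m]\subseteq[s,e]$ with $s_m<e_m$; otherwise draw $\tilde M$ intervals $[s_m,e_m]\subseteq[s,e]$, $s_m<e_m$, endpoints uniform on $\{s,\ldots,e\}$, independent, with replacement. Let $(m_0,b_{m_0})=\arg\max_{m,\ b\in\{s_m,\ldots,e_m-1\}}|\tilde X_{s_m,e_m}^b|$, record $(s_{m_0},e_{m_0},b_{m_0},|\tilde X_{s_{m_0},e_{m_0}}^{b_{m_0}}|)$ in $\tilde{\mathcal P}$ (initially empty), and recurse on $[s,b_{m_0}]$ and $[b_{m_0}+1,e]$. The sorted WBS2 solution path is $\tilde{\mathcal P}$ from the call $\textsc{WBS2.Sol.Path}(1,T,\tilde M)$, sorted so that the fourth components are non-increasing (ties broken at random); its elements are indexed $k=1,\ldots,T-1$.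 *)

theory Defs
  imports "HOL-Probability.Probability"
begin

text \<open>Records of the WBS2 solution path: (s, e, b, |CUSUM|).\<close>
type_synonym wbs_rec = "nat \<times> nat \<times> nat \<times> real"

definition rec_b :: "wbs_rec \<Rightarrow> nat" where "rec_b r = fst (snd (snd r))"
definition rec_stat :: "wbs_rec \<Rightarrow> real" where "rec_stat r = snd (snd (snd r))"

definition cusum :: "(nat \<Rightarrow> real) \<Rightarrow> nat \<Rightarrow> nat \<Rightarrow> nat \<Rightarrow> real" where
  "cusum x s e b =
     (let n = real (e - s + 1) in
        sqrt (real (e - b) / (n * real (b - s + 1))) * (\<Sum>t = s..b. x t)
      - sqrt (real (b - s + 1) / (n * real (e - b))) * (\<Sum>t = b + 1..e. x t))"

definition intervals :: "nat \<Rightarrow> nat \<Rightarrow> (nat \<times> nat) set" where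
  "intervals s e = {(a, c). s \<le> a \<and> a < c \<and> c \<le> e}"

primrec iid_list :: "nat \<Rightarrow> 'a pmf \<Rightarrow> 'a list pmf" where
  "iid_list 0 p = return_pmf []"
| "iid_list (Suc n) p = bind_pmf p (\<lambda>y. bind_pmf (iid_list n p) (\<lambda>ys. return_pmf (y # ys)))"

definition draw_intervals :: "nat \<Rightarrow> nat \<Rightarrow> nat \<Rightarrow> (nat \<times> nat) set pmf" where
  "draw_intervals M s e =
     (if (e - s + 1) * (e - s) \<le> 2 * M then return_pmf (intervals s e)
      else map_pmf set (iid_list M (pmf_of_set (intervals s e))))"

definition candidates :: "(nat \<times> nat) set \<Rightarrow> (nat \<times> nat \<times> nat) set" where
  "candidates I = {(a, c, b). (a, c) \<in> I \<and> a \<le> b \<and> b < c}"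

definition argmax_set :: "(nat \<Rightarrow> real) \<Rightarrow> (nat \<times> nat) set \<Rightarrow> (nat \<times> nat \<times> nat) set" where
  "argmax_set x I =
     {r \<in> candidates I.
        \<bar>cusum x (fst r) (fst (snd r)) (snd (snd r))\<bar>
        = Max ((\<lambda>r'. \<bar>cusum x (fst r') (fst (snd r')) (snd (snd r'))\<bar>) ` candidates I)}"

text \<open>WBS2.Sol.Path(s,e,M) on data x; the first argument is recursion fuel
  (sufficient whenever it is at least e - s).  Ties in the argmax are broken
  uniformly at random.\<close>
primrec wbs2_rec :: "nat \<Rightarrow> (nat \<Rightarrow> real) \<Rightarrow> nat \<Rightarrow> nat \<Rightarrow> nat \<Rightarrow> wbs_rec list pmf" where
  "wbs2_rec 0 x M s e = return_pmf []"
| "wbs2_rec (Suc k) x M s e =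
     (if e \<le> s then return_pmf []
      else bind_pmf (draw_intervals M s e) (\<lambda>I.
           bind_pmf (pmf_of_set (argmax_set x I)) (\<lambda>(a, c, b).
           bind_pmf (wbs2_rec k x M s b) (\<lambda>L.
           bind_pmf (wbs2_rec k x M (b + 1) e) (\<lambda>R.
           return_pmf ((a, c, b, \<bar>cusum x a c b\<bar>) # L @ R))))))"

definition sort_desc_random :: "wbs_rec list \<Rightarrow> wbs_rec list pmf" where
  "sort_desc_random P =
     pmf_of_set {ys. mset ys = mset P \<and> sorted_wrt (\<lambda>u v. rec_stat v \<le> rec_stat u) ys}"

definition wbs2_path :: "(nat \<Rightarrow> real) \<Rightarrow> nat \<Rightarrow> nat \<Rightarrow> wbs_rec list pmf" where
  "wbs2_path x T M = bind_pmf (wbs2_rec T x M 1 T) sort_desc_random"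

definition noise :: "real \<Rightarrow> nat \<Rightarrow> (nat \<Rightarrow> real) measure" where
  "noise \<sigma> T = PiM {1..T} (\<lambda>_. density lborel (normal_density 0 \<sigma>))"

definition event_B :: "real \<Rightarrow> real \<Rightarrow> nat \<Rightarrow> (nat \<Rightarrow> real) set" where
  "event_B \<Delta> \<sigma> T =
     {\<epsilon> \<in> space (noise \<sigma> T). \<forall>l m. 1 \<le> l \<and> l \<le> m \<and> m \<le> T \<longrightarrow>
        \<bar>\<Sum>i = l..m. \<epsilon> i\<bar> / sqrt (real (m - l + 1)) \<le> \<sigma> * sqrt (2 * (1 + \<Delta>) * ln (real T))}"

definition alpha :: "real \<Rightarrow> real \<Rightarrow> nat \<Rightarrow> real" where
  "alpha \<Delta> \<sigma> T = 1 - measure (noise \<sigma> T) (event_B \<Delta> \<sigma> T)"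

text \<open>The event A_T, as a set of sorted solution paths (indexed from 0 here, i.e.
  element k of the paper is ys ! (k-1)).\<close>
definition event_A ::
  "nat \<Rightarrow> nat \<Rightarrow> (nat \<Rightarrow> nat) \<Rightarrow> real \<Rightarrow> real \<Rightarrow> real \<Rightarrow> real \<Rightarrow> wbs_rec list set" where
  "event_A T N \<eta> fT C1 C2 c =
     {ys. (let bs = sort (map rec_b (take N ys)) in
             \<forall>i\<in>{1..N}. \<bar>real (\<eta> i) - real (bs ! (i - 1))\<bar> \<le> C1 * (1 / fT\<^sup>2) * ln (real T))
        \<and> (\<forall>k<N. rec_stat (ys ! k) \<ge> c * fT * sqrt (real T))
        \<and> (\<forall>k. N \<le> k \<and> k < T - 1 \<longrightarrow> rec_stat (ys ! k) \<le> C2 * sqrt (ln (real T)))}"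

end

theory Submission
  imports Defs
begin

text \<open>
On the event \<open>event_B\<close> the recursion is followed with an invariant: on the current \<open>[s, e]\<close> the data are
\<open>g + noise\<close>, where \<open>g\<close> jumps only at the undetected change-points inside, all far from \<open>s\<close> and \<open>e\<close>, and
every block of \<open>L\<close> noise terms sums to at most \<open>\<Lambda> * sqrt L\<close>. If some drawn interval isolates the
undetected change-point \<open>h0\<close> with the largest jump \<open>d\<close>, then the maximal CUSUM is of order
\<open>d * sqrt T\<close>, and a convexity argument places its argmax within \<open>O(\<Lambda>\<^sup>2 / d\<^sup>2)\<close> of an undetected
change-point \<open>h\<close>. As the jump at \<open>h\<close> is at most \<open>d\<close>, the misplaced piece of signal near the new
boundary has Euclidean norm \<open>O(\<Lambda>)\<close> and can be absorbed into the noise, which multiplies \<open>\<Lambda>\<close> by a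
constant. There are at most \<open>1 / \<delta>\<close> change-points, so \<open>\<Lambda>\<close> stays of order \<open>sqrt (ln T)\<close>; once no
change-point is left, every CUSUM is at most \<open>2 * \<Lambda>\<close>. An isolating interval is missed with
probability at most \<open>(1 - \<delta>\<^sup>2 / 9) ^ M\<close>, and this can happen only once per change-point.
\<close>

section \<open>The CUSUM statistic of signal and noise\<close>

text \<open>Randomness is used one call at a time. Given \<open>[s, e]\<close>, the draw made in
  that call is fresh and misses all isolating intervals of one chosen point with small probability;
  on \<open>event_B\<close> everything else is deterministic. So no union over the possible
  positions of \<open>[s, e]\<close> is taken, and the failure probabilities simply add up to
  \<open>N * (1 - \<delta>\<^sup>2 / 9) ^ M\<close>. The obstacle is that a split falls near a
  change-point and not on it, so a subinterval can still contain a true jump close to one end.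
  Absorbing that jump works because the recursion asks only one thing of the noise, the square-root
  law for block sums, and this law survives any perturbation of bounded Euclidean norm. Independence
  and the Gaussian law need not be carried along. The geometry does not deteriorate with depth: each
  new end lies near a detected change-point, and the remaining ones keep their full distance from
  that point.\<close>

definition odds :: "nat \<Rightarrow> nat \<Rightarrow> nat \<Rightarrow> real" where
  "odds a c t = sqrt (real (t - a + 1) / real (c - t))"

lemma odds_pos: "t < c \<Longrightarrow> 0 < odds a c t"
  by (simp add: odds_def)

lemma odds_square: "t < c \<Longrightarrow> (odds a c t)\<^sup>2 = real (t - a + 1) / real (c - t)"
  by (simp add: odds_def)

lemma odds_less:
  assumes "a \<le> i" "i < j" "j < c"
  shows "odds a c i < odds a c j"
  unfolding odds_def using assms by (intro real_sqrt_less_mono frac_less) auto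

lemma sum_atLeastAtMost_split:
  fixes y :: "nat \<Rightarrow> real"
  assumes "a \<le> i + 1" "i \<le> j"
  shows "(\<Sum>t = a..j. y t) = (\<Sum>t = a..i. y t) + (\<Sum>t = i+1..j. y t)"
proof -
  have "{a..j} = {a..i} \<union> {i+1..j}" using assms by auto
  then show ?thesis by (simp add: sum.union_disjoint)
qed

lemma cusum_diff:
  "cusum (\<lambda>t. x t - y t) a c b = cusum x a c b - cusum y a c b"
  by (simp add: cusum_def Let_def sum_subtractf algebra_simps)

section \<open>Noise bounds for single CUSUM values and their increments\<close>

lemma sqrt_mult_le_cauchy3:
  fixes x1 x2 x3 s1 s2 s3 l1 l2 l3 \<Lambda> :: real
  assumes "0 \<le> l1" "0 \<le> l2" "0 \<le> l3" "0 \<le> \<Lambda>"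
    and s: "\<bar>s1\<bar> \<le> \<Lambda> * sqrt l1" "\<bar>s2\<bar> \<le> \<Lambda> * sqrt l2" "\<bar>s3\<bar> \<le> \<Lambda> * sqrt l3"
  shows "\<bar>x1 * s1 + x2 * s2 + x3 * s3\<bar> \<le> \<Lambda> * sqrt (3 * (x1\<^sup>2 * l1 + x2\<^sup>2 * l2 + x3\<^sup>2 * l3))"
proof -
  define p q r where pqr: "p = \<bar>x1\<bar> * sqrt l1" "q = \<bar>x2\<bar> * sqrt l2" "r = \<bar>x3\<bar> * sqrt l3"
  have "\<bar>x1 * s1 + x2 * s2 + x3 * s3\<bar> \<le> \<bar>x1\<bar> * \<bar>s1\<bar> + \<bar>x2\<bar> * \<bar>s2\<bar> + \<bar>x3\<bar> * \<bar>s3\<bar>"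
    unfolding abs_mult[symmetric] by linarith
  also have "\<dots> \<le> \<bar>x1\<bar> * (\<Lambda> * sqrt l1) + \<bar>x2\<bar> * (\<Lambda> * sqrt l2) + \<bar>x3\<bar> * (\<Lambda> * sqrt l3)"
    using s by (intro add_mono mult_left_mono) auto
  also have "\<dots> = \<Lambda> * (p + q + r)" by (simp add: pqr algebra_simps)
  also have "p + q + r \<le> sqrt (3 * (p\<^sup>2 + q\<^sup>2 + r\<^sup>2))"
  proof (rule real_le_rsqrt)
    have "0 \<le> (p - q)\<^sup>2 + (q - r)\<^sup>2 + (p - r)\<^sup>2" by simp
    then show "(p + q + r)\<^sup>2 \<le> 3 * (p\<^sup>2 + q\<^sup>2 + r\<^sup>2)"
      by (simp add: power2_eq_square algebra_simps)
  qed
  also have "p\<^sup>2 + q\<^sup>2 + r\<^sup>2 = x1\<^sup>2 * l1 + x2\<^sup>2 * l2 + x3\<^sup>2 * l3"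
    using assms by (simp add: pqr power_mult_distrib)
  finally show ?thesis using \<open>0 \<le> \<Lambda>\<close> by (simp add: mult_left_mono)
qed

text \<open>Each of the two blocks of the contrast vector has Euclidean norm at most 1. A constant
  weight of that norm against a block sum obeying the square-root law contributes at most
  \<open>\<Lambda>\<close>, hence the factor 2.\<close>

lemma cusum_noise_bound:
  assumes "a \<le> b" "b < c" "0 \<le> \<Lambda>"
    and noise: "\<And>l m. a \<le> l \<Longrightarrow> l \<le> m \<Longrightarrow> m \<le> c \<Longrightarrow>
      \<bar>\<Sum>t = l..m. y t\<bar> \<le> \<Lambda> * sqrt (real (m - l + 1))"
  shows "\<bar>cusum y a c b\<bar> \<le> 2 * \<Lambda>"
proof -
  define u v where uv: "u = real (b - a + 1)" "v = real (c - b)"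
  have pos: "u > 0" "v > 0" and n: "real (c - a + 1) = u + v"
    using assms by (auto simp: uv)
  define A B where AB: "A = (\<Sum>t = a..b. y t)" "B = (\<Sum>t = b+1..c. y t)"
  have A: "\<bar>A\<bar> \<le> \<Lambda> * sqrt u" using noise[of a b] assms by (simp add: AB uv)
  have B: "\<bar>B\<bar> \<le> \<Lambda> * sqrt v" using noise[of "b+1" c] assms 
    by (simp add: AB uv Suc_diff_Suc flip: of_nat_Suc)
  have "cusum y a c b = sqrt (v / ((u + v) * u)) * A - sqrt (u / ((u + v) * v)) * B"
    by (simp only: cusum_def Let_def n uv[symmetric] AB[symmetric])
  also have "\<bar>\<dots>\<bar> \<le> \<bar>sqrt (v / ((u + v) * u)) * A\<bar> + \<bar>sqrt (u / ((u + v) * v)) * B\<bar>"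
    by (rule abs_triangle_ineq4)
  also have "\<dots> = sqrt (v / ((u + v) * u)) * \<bar>A\<bar> + sqrt (u / ((u + v) * v)) * \<bar>B\<bar>"
    using pos by (simp add: abs_mult)
  also have "\<dots> \<le> sqrt (v / ((u + v) * u)) * (\<Lambda> * sqrt u) + sqrt (u / ((u + v) * v)) * (\<Lambda> * sqrt v)"
    using A B pos by (intro add_mono mult_left_mono) auto
  also have "\<dots> = \<Lambda> * sqrt (v / (u + v)) + \<Lambda> * sqrt (u / (u + v))"
    using pos by (simp add: real_sqrt_mult real_sqrt_divide mult.commute)
  also have "\<dots> \<le> \<Lambda> * 1 + \<Lambda> * 1"
    using pos assms by (intro add_mono mult_left_mono) auto
  finally show ?thesis by simp
qed

text \<open>Writing \<open>cusum y a c i = \<langle>y, \<psi> i\<rangle>\<close> with unit vectors \<open>\<psi> i\<close>, one has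
  \<open>\<langle>\<psi> i, \<psi> j\<rangle> = odds a c i / odds a c j\<close>; the difference \<open>\<psi> i - \<psi> j\<close> is constant on three blocks.\<close>
lemma cusum_noise_diff_bound:
  assumes ij: "a \<le> i" "i < j" "j < c" and L: "0 \<le> \<Lambda>"
    and noise: "\<And>l m. a \<le> l \<Longrightarrow> l \<le> m \<Longrightarrow> m \<le> c \<Longrightarrow>
      \<bar>\<Sum>t = l..m. y t\<bar> \<le> \<Lambda> * sqrt (real (m - l + 1))"
  shows "\<bar>cusum y a c i - cusum y a c j\<bar> \<le> \<Lambda> * sqrt (6 * (1 - odds a c i / odds a c j))"
proof -
  define u v u' v' where uv: "u = real (i - a + 1)" "v = real (c - i)"
     "u' = real (j - a + 1)" "v' = real (c - j)"
  define D where "D = real (j - i)"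
  have pos: "u > 0" "v > 0" "u' > 0" "v' > 0" "D > 0"
    and n: "real (c - a + 1) = u + v" and v'D: "v = v' + D" and u'D: "u' = u + D"
    using assms by (auto simp: uv D_def)
  define n where "n = u + v"
  have npos: "n > 0" and n1: "n = u + v" and n2: "n = u' + v'" using pos v'D u'D by (auto simp: n_def)
  define s1 s2 s3 where s: "s1 = (\<Sum>t = a..i. y t)" "s2 = (\<Sum>t = i+1..j. y t)" "s3 = (\<Sum>t = j+1..c. y t)"
  have b: "\<bar>s1\<bar> \<le> \<Lambda> * sqrt u" using noise[of a i] ij by (simp add: s uv)
  have b2: "\<bar>s2\<bar> \<le> \<Lambda> * sqrt D" using noise[of "i+1" j] ij 
    by (simp add: s D_def Suc_diff_Suc flip: of_nat_Suc)
  have b3: "\<bar>s3\<bar> \<le> \<Lambda> * sqrt v'" using noise[of "j+1" c] ij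
    by (simp add: s uv Suc_diff_Suc flip: of_nat_Suc)
  have s12: "(\<Sum>t = a..j. y t) = s1 + s2" and s23: "(\<Sum>t = i+1..c. y t) = s2 + s3"
    unfolding s using ij sum_atLeastAtMost_split[of a i j y] sum_atLeastAtMost_split[of "i+1" j c y] by auto
  define \<alpha> \<alpha>' \<beta> \<beta>' where ab: "\<alpha> = sqrt (v' / (n * u'))" "\<alpha>' = sqrt (u' / (n * v'))"
      "\<beta> = sqrt (v / (n * u))" "\<beta>' = sqrt (u / (n * v))"
  have ci: "cusum y a c i = \<beta> * s1 - \<beta>' * (s2 + s3)"
    by (simp only: cusum_def Let_def n uv[symmetric] s(1)[symmetric] s23 ab n_def)
  have cj: "cusum y a c j = \<alpha> * (s1 + s2) - \<alpha>' * s3"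
    by (simp only: cusum_def Let_def n uv[symmetric] s(3)[symmetric] s12 ab n_def)
  define r where "r = odds a c i / odds a c j"
  have r: "r = sqrt ((u * v') / (v * u'))"
    unfolding r_def odds_def uv[symmetric] by (simp add: real_sqrt_mult real_sqrt_divide)
  \<comment> \<open>\<open>e1\<close>, \<open>e2\<close> (times \<open>D\<close>) and
    \<open>e3\<close> are the contributions of the three blocks to the inner product of the two
    contrast vectors, the middle one entering with a minus sign. They add up to \<open>r\<close>
    because \<open>v - D + u' = n\<close>.\<close>
  have e1: "\<alpha> * \<beta> * u = r * v / n"
  proof -
    have "\<alpha> * \<beta> = sqrt ((v' / (n * u')) * (v / (n * u)))" by (simp only: ab real_sqrt_mult)
    also have "(v' / (n * u')) * (v / (n * u)) = ((u * v') / (v * u')) * (v / (n * u))\<^sup>2"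
      using pos npos by (simp add: field_simps power2_eq_square)
    also have "sqrt \<dots> = r * (v / (n * u))" using pos npos by (simp only: real_sqrt_mult r real_sqrt_abs) simp
    finally show ?thesis using pos by simp
  qed
  have e2: "\<alpha> * \<beta>' = r / n"
  proof -
    have "\<alpha> * \<beta>' = sqrt ((v' / (n * u')) * (u / (n * v)))" by (simp only: ab real_sqrt_mult)
    also have "(v' / (n * u')) * (u / (n * v)) = ((u * v') / (v * u')) * (1 / n)\<^sup>2"
      using pos npos by (simp add: field_simps power2_eq_square)
    also have "sqrt \<dots> = r * (1 / n)" using pos npos by (simp only: real_sqrt_mult r real_sqrt_abs) simp
    finally show ?thesis using pos by simp
  qed
  have e3: "\<alpha>' * \<beta>' * v' = r * u' / n"
  proof -
    have "\<alpha>' * \<beta>' = sqrt ((u' / (n * v')) * (u / (n * v)))" by (simp only: ab real_sqrt_mult)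
    also have "(u' / (n * v')) * (u / (n * v)) = ((u * v') / (v * u')) * (u' / (n * v'))\<^sup>2"
      using pos npos by (simp add: field_simps power2_eq_square)
    also have "sqrt \<dots> = r * (u' / (n * v'))" using pos npos by (simp only: real_sqrt_mult r real_sqrt_abs) simp
    finally show ?thesis using pos by simp
  qed
  have sq: "\<alpha>\<^sup>2 * u' + \<alpha>'\<^sup>2 * v' = 1" "\<beta>\<^sup>2 * u + \<beta>'\<^sup>2 * v = 1"
  proof -
    have "\<alpha>\<^sup>2 * u' = v' / n" "\<alpha>'\<^sup>2 * v' = u' / n" "\<beta>\<^sup>2 * u = v / n" "\<beta>'\<^sup>2 * v = u / n"
      using pos npos by (simp_all add: ab field_simps)
    then show "\<alpha>\<^sup>2 * u' + \<alpha>'\<^sup>2 * v' = 1" "\<beta>\<^sup>2 * u + \<beta>'\<^sup>2 * v = 1"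
      using npos n1 n2 by (simp_all flip: add_divide_distrib add: add.commute)
  qed
  have "cusum y a c i - cusum y a c j = (\<beta> - \<alpha>) * s1 + (- \<beta>' - \<alpha>) * s2 + (\<alpha>' - \<beta>') * s3"
    by (simp add: ci cj algebra_simps)
  also have "\<bar>\<dots>\<bar> \<le> \<Lambda> * sqrt (3 * ((\<beta> - \<alpha>)\<^sup>2 * u + (- \<beta>' - \<alpha>)\<^sup>2 * D + (\<alpha>' - \<beta>')\<^sup>2 * v'))"
    using pos L b b2 b3 by (intro sqrt_mult_le_cauchy3) auto
  \<comment> \<open>The bracket is the squared distance of two unit vectors with inner product
    \<open>r\<close>, that is \<open>2 - 2 * r\<close>. The factor 3 for the three blocks turns this
    into the 6 of the claim.\<close>
  also have "(\<beta> - \<alpha>)\<^sup>2 * u + (- \<beta>' - \<alpha>)\<^sup>2 * D + (\<alpha>' - \<beta>')\<^sup>2 * v'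
      = (\<alpha>\<^sup>2 * u' + \<alpha>'\<^sup>2 * v') + (\<beta>\<^sup>2 * u + \<beta>'\<^sup>2 * v) - 2 * (\<alpha> * \<beta> * u - (\<alpha> * \<beta>') * D + \<alpha>' * \<beta>' * v')"
    unfolding u'D v'D by (simp add: power2_eq_square algebra_simps)
  also have "\<dots> = 2 - 2 * (r * (v - D + u') / n)"
    unfolding sq e1 e2 e3 using npos by (simp add: field_simps)
  also have "v - D + u' = n" using v'D n2 by simp
  finally show ?thesis using npos by (simp add: r_def algebra_simps)
qed

text \<open>Translates the correlation \<open>r\<close> of two contrast vectors back into a distance
  in time: exactly \<open>1 - r^2 = D * (u + v) / (v * u')\<close>, the denominator is at most
  \<open>(u + v) * T\<close>, and \<open>1 + r\<close> is at most 2.\<close>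

lemma odds_ratio_gap:
  assumes ij: "a \<le> i" "i < j" "j < c" and T: "c - a + 1 \<le> T"
  shows "real (j - i) \<le> 2 * real T * (1 - odds a c i / odds a c j)"
proof -
  define u v u' v' where uv: "u = real (i - a + 1)" "v = real (c - i)"
     "u' = real (j - a + 1)" "v' = real (c - j)"
  define D where "D = real (j - i)"
  have pos: "u > 0" "v > 0" "u' > 0" "v' > 0" "D > 0"
    and v'D: "v = v' + D" and u'D: "u' = u + D"
    and T': "u + v \<le> real T"
    using assms by (auto simp: uv D_def)
  define r where "r = odds a c i / odds a c j"
  have r0: "0 \<le> r" "r \<le> 1" unfolding r_def using odds_less[OF ij] odds_pos[of i c a] odds_pos[of j c a] ij by auto
  have "r\<^sup>2 = (u * v') / (v * u')"
    unfolding r_def power_divide using ij by (simp only: odds_square[OF order.strict_trans[OF ij(2,3)]] odds_square[OF ij(3)] uv[symmetric]) (simp add: field_simps)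
  then have "1 - r\<^sup>2 = (v * u' - u * v') / (v * u')" using pos by (simp add: field_simps)
  also have "v * u' - u * v' = D * (u + v)" unfolding v'D u'D by (simp add: algebra_simps)
  finally have e: "1 - r\<^sup>2 = D * (u + v) / (v * u')" .
  have "v * u' \<le> (u + v) * real T" 
    using pos T' v'D u'D by (intro mult_mono) auto
  then have "D * (v * u') \<le> D * ((u + v) * real T)" using pos by (intro mult_left_mono) auto
  then have "D \<le> real T * (1 - r\<^sup>2)" unfolding e using pos by (simp add: field_simps)
  also have "1 - r\<^sup>2 = (1 - r) * (1 + r)" by (simp add: power2_eq_square algebra_simps)
  also have "real T * ((1 - r) * (1 + r)) \<le> real T * ((1 - r) * 2)"
    using r0 by (intro mult_left_mono) auto
  finally show ?thesis by (simp add: D_def r_def algebra_simps)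
qed

lemma odds_ratio_separated:
  assumes ij: "a \<le> i" "i < j" "j < c" and T: "c - a + 1 \<le> T"
    and sep: "\<rho> * real T \<le> real (j - i)" and \<rho>: "0 < \<rho>"
  shows "odds a c i / odds a c j \<le> 1 - \<rho> / 2"
proof -
  have "\<rho> * real T \<le> 2 * real T * (1 - odds a c i / odds a c j)" using odds_ratio_gap[OF ij T] sep by simp
  moreover have "real T > 0" using T by simp
  ultimately have "\<rho> \<le> 2 * (1 - odds a c i / odds a c j)" 
    by (metis mult.assoc mult.commute mult_le_cancel_left_pos)
  then show ?thesis by simp
qed

text \<open>Think of \<open>P + Q\<close> as the value of \<open>A / z + B * z\<close> at the
  current split. Scaling \<open>z\<close> by \<open>x\<close> or by \<open>1 / y\<close> adds
  \<open>(1 - x) * (P / x - Q)\<close> or \<open>(1 - y) * (Q / y - P)\<close>. If both brackets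
  were below \<open>k\<close>, then \<open>P\<close> and \<open>Q\<close> would each be below
  \<open>2 * k / (1 - x * y)\<close>, too little to add up to \<open>G\<close>; the bound on
  \<open>x * y\<close> says that the two targets are far apart.\<close>

lemma two_sided_gain:
  fixes P Q x y G \<rho> :: real
  assumes "P + Q = G" "0 < G" "0 < x" "x < 1" "0 < y" "y < 1" "x * y \<le> 1 - \<rho>" "0 < \<rho>"
  shows "\<rho> / 4 * G \<le> P / x - Q \<or> \<rho> / 4 * G \<le> Q / y - P"
proof (rule ccontr)
  define k where "k = \<rho> / 4 * G"
  assume "\<not> ?thesis"
  then have "P / x < Q + k" "Q / y < P + k" unfolding k_def by linarith+
  then have P: "P < x * (Q + k)" and Q: "Q < y * (P + k)" using assms by (auto simp: field_simps)
  have k: "k > 0" using assms by (simp add: k_def)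
  have "x * y > 0" using assms by simp
  have "y * P \<le> y * (x * (Q + k))" using P assms by (intro mult_left_mono) auto
  then have "Q < x * y * Q + (x * y + y) * k" using Q by (simp add: algebra_simps)
  also have "(x * y + y) * k \<le> 2 * k" using k assms by (intro mult_right_mono) auto
  finally have Q': "(1 - x * y) * Q < 2 * k" by (simp add: algebra_simps)
  have "x * Q \<le> x * (y * (P + k))" using Q assms by (intro mult_left_mono) auto
  then have "P < x * y * P + (x * y + x) * k" using P by (simp add: algebra_simps)
  also have "(x * y + x) * k \<le> 2 * k" using k assms by (intro mult_right_mono) auto
  finally have P': "(1 - x * y) * P < 2 * k" by (simp add: algebra_simps)
  have "\<rho> * G \<le> (1 - x * y) * G" using assms by (intro mult_right_mono) auto
  also have "\<dots> < 4 * k" using P' Q' assms(1) by (simp add: algebra_simps flip: assms(1))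
  finally show False by (simp add: k_def)
qed

section \<open>The CUSUM of a signal along a constant piece\<close>

lemma sqrt_divide_mult:
  fixes n u v :: real
  assumes "0 < n" "0 < u" "0 < v"
  shows "sqrt (v / (n * u)) = v / sqrt (n * u * v)"
proof -
  have "v / sqrt (n * u * v) = (sqrt v * sqrt v) / (sqrt (n * u) * sqrt v)"
    unfolding real_sqrt_mult using assms by simp
  also have "\<dots> = sqrt v / sqrt (n * u)" using assms by (simp del: real_sqrt_mult_self)
  finally show ?thesis by (simp add: real_sqrt_divide)
qed

lemma cusum_alt:
  assumes "a \<le> b" "b < c"
  shows "cusum y a c b = (real (c - a + 1) * (\<Sum>t = a..b. y t) - real (b - a + 1) * (\<Sum>t = a..c. y t))
     / sqrt (real (c - a + 1) * real (b - a + 1) * real (c - b))"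
proof -
  define u v where uv: "u = real (b - a + 1)" "v = real (c - b)"
  have pos: "u > 0" "v > 0" and n: "real (c - a + 1) = u + v"
    using assms by (auto simp: uv)
  define A B where AB: "A = (\<Sum>t = a..b. y t)" "B = (\<Sum>t = b+1..c. y t)"
  have AB': "(\<Sum>t = a..c. y t) = A + B"
    unfolding AB using assms by (intro sum_atLeastAtMost_split) auto
  have e1: "sqrt (v / ((u + v) * u)) = v / sqrt ((u + v) * u * v)"
    using pos by (intro sqrt_divide_mult) auto
  have e2: "sqrt (u / ((u + v) * v)) = u / sqrt ((u + v) * u * v)"
    using pos sqrt_divide_mult[of "u + v" v u] by (simp add: mult.commute mult.left_commute)
  have "cusum y a c b = sqrt (v / ((u + v) * u)) * A - sqrt (u / ((u + v) * v)) * B"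
    by (simp only: cusum_def Let_def n uv[symmetric] AB[symmetric])
  also have "\<dots> = (v * A - u * B) / sqrt ((u + v) * u * v)"
    unfolding e1 e2 by (simp add: diff_divide_distrib)
  also have "v * A - u * B = (u + v) * A - u * (A + B)" by (simp add: algebra_simps)
  finally show ?thesis by (simp only: n AB' uv[symmetric] AB[symmetric])
qed

text \<open>Partial sums are affine in \<open>t\<close> along the piece, so the numerator in
  \<open>cusum_alt\<close> is a linear combination of the lengths left and right of
  \<open>t\<close>. \<open>A\<close> is a multiple of the partial sum extrapolated to
  \<open>a - 1\<close>, and \<open>B\<close> of the extrapolation to \<open>c\<close> minus the true
  total; each vanishes when the piece reaches the corresponding end.\<close>

lemma cusum_on_constant_piece:
  assumes "a \<le> p + 1" "p \<le> q" "q \<le> c" "a \<le> c" and const: "\<And>t. p < t \<Longrightarrow> t \<le> q \<Longrightarrow> y t = w"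
  obtains A B where
    "\<And>t. p \<le> t \<Longrightarrow> t \<le> q \<Longrightarrow> a \<le> t \<Longrightarrow> t < c \<Longrightarrow> cusum y a c t = A / odds a c t + B * odds a c t"
    "p + 1 = a \<Longrightarrow> A = 0" "q = c \<Longrightarrow> B = 0"
proof -
  define P where "P = (\<Sum>t = a..p. y t)"
  define S where "S = (\<Sum>t = a..c. y t)"
  define n where "n = real (c - a + 1)"
  define up where "up = real p + 1 - real a"
  have n: "n > 0" by (simp add: n_def)
  have part: "(\<Sum>i = a..t. y i) = P + (real t - real p) * w" if "p \<le> t" "t \<le> q" for t
  proof -
    have "(\<Sum>i = p+1..t. y i) = (\<Sum>i = p+1..t. w)" using const that by (intro sum.cong) auto
    then show ?thesis unfolding P_def using sum_atLeastAtMost_split[of a p t y] assms that 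
      by (simp add: of_nat_diff)
  qed
  define \<alpha> \<beta> where ab: "\<alpha> = P - up * w" "\<beta> = n * w - S + \<alpha>"
  show ?thesis
  proof (rule that[of "\<alpha> / sqrt n" "\<beta> / sqrt n"])
    fix t assume t: "p \<le> t" "t \<le> q" "a \<le> t" "t < c"
    define u v where uv: "u = real (t - a + 1)" "v = real (c - t)"
    have pos: "u > 0" "v > 0" and nuv: "n = u + v" using t by (auto simp: uv n_def)
    have tp: "real t - real p = u - up" using t by (simp add: uv up_def)
    have "cusum y a c t = (n * (P + (u - up) * w) - u * S) / sqrt (n * u * v)"
      unfolding cusum_alt[OF t(3,4)] part[OF t(1,2)] tp S_def[symmetric] n_def[symmetric] uv[symmetric] ..
    also have "n * (P + (u - up) * w) - u * S = \<alpha> * v + \<beta> * u"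
      unfolding ab nuv by (simp add: algebra_simps)
    also have "(\<alpha> * v + \<beta> * u) / sqrt (n * u * v) = \<alpha> / sqrt n * (v / sqrt (u * v)) + \<beta> / sqrt n * (u / sqrt (u * v))"
      by (simp add: add_divide_distrib real_sqrt_mult mult.assoc)
    also have "v / sqrt (u * v) = 1 / odds a c t" unfolding odds_def uv[symmetric] 
      using pos by (simp add: real_sqrt_mult real_sqrt_divide field_simps)
    also have "u / sqrt (u * v) = odds a c t" unfolding odds_def uv[symmetric] 
      using pos by (simp add: real_sqrt_mult real_sqrt_divide field_simps)
    finally show "cusum y a c t = \<alpha> / sqrt n / odds a c t + \<beta> / sqrt n * odds a c t" by simp
  next
    assume "p + 1 = a"
    then show "\<alpha> / sqrt n = 0" by (simp add: ab up_def P_def flip: \<open>p + 1 = a\<close>)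
  next
    assume "q = c"
    then have "S = P + (real c - real p) * w" unfolding S_def using part[of c] assms by simp
    then have "\<beta> = 0" using assms by (simp add: ab up_def n_def algebra_simps of_nat_diff)
    then show "\<beta> / sqrt n = 0" by simp
  qed
qed

lemma constant_between:
  fixes g :: "nat \<Rightarrow> real"
  assumes "\<And>t. l < t \<Longrightarrow> t \<le> r \<Longrightarrow> g t = g (t - 1)" "l \<le> t" "t \<le> r"
  shows "g t = g l"
  using assms(2,3)
proof (induction t)
  case (Suc t)
  show ?case
  proof (cases "l = Suc t")
    case False
    then show ?thesis using Suc assms(1)[of "Suc t"] by auto
  qed auto
qed auto

text \<open>A gain linear in \<open>1 - r\<close> is outweighed by a fluctuation of order
  \<open>sqrt (1 - r)\<close> only if \<open>1 - r\<close> is small: square, and cancel one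
  factor.\<close>

lemma gain_noise_tradeoff:
  fixes \<kappa> G r \<Lambda> T D :: real
  assumes "\<kappa> * G * (1 - r) \<le> \<Lambda> * sqrt (6 * (1 - r))" "0 < \<kappa>" "0 < G" "r < 1" "0 \<le> \<Lambda>"
    and "D \<le> 2 * T * (1 - r)" "0 \<le> T"
  shows "D \<le> 12 * T * \<Lambda>\<^sup>2 / (\<kappa>\<^sup>2 * G\<^sup>2)"
proof -
  have "(\<kappa> * G * (1 - r))\<^sup>2 \<le> (\<Lambda> * sqrt (6 * (1 - r)))\<^sup>2"
    using assms by (intro power_mono) auto
  then have "(\<kappa>\<^sup>2 * G\<^sup>2 * (1 - r)) * (1 - r) \<le> (6 * \<Lambda>\<^sup>2) * (1 - r)"
    using assms by (simp add: power_mult_distrib power2_eq_square algebra_simps)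
  then have "\<kappa>\<^sup>2 * G\<^sup>2 * (1 - r) \<le> 6 * \<Lambda>\<^sup>2" using assms by (simp only: mult_le_cancel_right_pos)
  then have "1 - r \<le> 6 * \<Lambda>\<^sup>2 / (\<kappa>\<^sup>2 * G\<^sup>2)" using assms by (simp add: field_simps)
  then have "2 * T * (1 - r) \<le> 2 * T * (6 * \<Lambda>\<^sup>2 / (\<kappa>\<^sup>2 * G\<^sup>2))" using assms by (intro mult_left_mono) auto
  then show ?thesis using assms(6) by simp
qed

text \<open>On a piece where \<open>g\<close> is constant its CUSUM is \<open>A / z + B * z\<close> with \<open>z = odds a c\<close>, a convex
  function; hence moving from \<open>b\<close> to one of the two adjacent change-points gains at least linearly,
  while the noise changes only like a square root.\<close>
lemma cusum_argmax_localization: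
  fixes x g :: "nat \<Rightarrow> real" and H :: "nat set"
  assumes ab: "1 \<le> a" "a \<le> b" "b < c" and T: "c - a + 1 \<le> T"
    and const: "\<And>t. a < t \<Longrightarrow> t \<le> c \<Longrightarrow> t \<notin> H \<Longrightarrow> g t = g (t - 1)"
    and sep: "\<And>h h'. h \<in> H \<Longrightarrow> h' \<in> H \<Longrightarrow> h < h' \<Longrightarrow> \<rho> * real T \<le> real h' - real h"
    and \<rho>: "0 < \<rho>" "\<rho> \<le> 1" and L: "0 \<le> \<Lambda>"
    and noise: "\<And>l m. a \<le> l \<Longrightarrow> l \<le> m \<Longrightarrow> m \<le> c \<Longrightarrow>
      \<bar>\<Sum>t = l..m. x t - g t\<bar> \<le> \<Lambda> * sqrt (real (m - l + 1))"
    and max: "\<And>b'. a \<le> b' \<Longrightarrow> b' < c \<Longrightarrow> \<bar>cusum x a c b'\<bar> \<le> \<bar>cusum x a c b\<bar>"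
    and big: "2 * \<Lambda> < \<bar>cusum g a c b\<bar>"
  shows "\<exists>h\<in>H. a < h \<and> h \<le> c \<and>
     \<bar>real h - 1 - real b\<bar> \<le> 768 * real T * \<Lambda>\<^sup>2 / (\<rho>\<^sup>2 * (cusum g a c b)\<^sup>2)"
proof (cases "b + 1 \<in> H")
  case True
  then show ?thesis using ab by (intro bexI[of _ "b+1"]) auto
next
  case b1: False
  define G where "G = \<bar>cusum g a c b\<bar>"
  have G: "0 < G" using big L by (simp add: G_def)
  define sg where "sg = sgn (cusum g a c b)"
  have sgG: "sg * cusum g a c b = G" by (simp add: sg_def G_def sgn_mult_self_eq mult.commute sgn_mult_abs abs_sgn)
  have sg1: "\<bar>sg\<bar> = 1" using G by (simp add: sg_def G_def abs_sgn_eq)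
  define e where "e = (\<lambda>t. x t - g t)"
  have cx: "cusum x a c t = cusum g a c t + cusum e a c t" for t
    using cusum_diff[of x g a c t] by (simp add: e_def)
  have eb: "\<bar>cusum e a c b\<bar> \<le> 2 * \<Lambda>"
    using cusum_noise_bound[OF ab(2,3) L, of e] noise by (simp add: e_def)
  \<comment> \<open>At \<open>b\<close> the noise is too weak to change the sign of the signal
    CUSUM, so maximality of the absolute value becomes a one-sided inequality for the CUSUM
    multiplied by \<open>sg\<close>.\<close>
  have sgx: "sg * cusum x a c b = \<bar>cusum x a c b\<bar>"
    using eb big unfolding cx sg_def by (auto simp: sgn_if abs_if split: if_splits)
  have gain: "sg * cusum g a c t - G \<le> \<bar>cusum e a c b - cusum e a c t\<bar>" if "a \<le> t" "t < c" for t
  proof -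
    have "sg * cusum x a c t \<le> \<bar>cusum x a c t\<bar>"
      using sg1 by (metis abs_ge_self abs_mult mult_1)
    also have "\<dots> \<le> sg * cusum x a c b" using max[OF that] sgx by simp
    finally have "sg * cusum g a c t - G \<le> sg * (cusum e a c b - cusum e a c t)"
      unfolding cx sgG[symmetric] by (simp add: algebra_simps)
    also have "\<dots> \<le> \<bar>cusum e a c b - cusum e a c t\<bar>"
      using sg1 by (metis abs_ge_self abs_mult mult_1)
    finally show ?thesis .
  qed
  \<comment> \<open>\<open>l\<close> and \<open>r\<close> are the change-points next to
    \<open>b\<close>. A split at \<open>t\<close> cuts after \<open>t\<close>, so the matching
    splits are \<open>p = l - 1\<close> and \<open>q = r - 1\<close>. The defaults \<open>a\<close>
    and \<open>c + 1\<close> give \<open>p = a - 1\<close> and \<open>q = c\<close>, which are no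
    admissible splits but make \<open>A\<close> or \<open>B\<close> vanish.\<close>
  define l where "l = (if {h\<in>H. a < h \<and> h \<le> b} = {} then a else Max {h\<in>H. a < h \<and> h \<le> b})"
  define r where "r = (if {h\<in>H. b < h \<and> h \<le> c} = {} then c + 1 else Min {h\<in>H. b < h \<and> h \<le> c})"
  have fin: "finite {h\<in>H. a < h \<and> h \<le> b}" "finite {h\<in>H. b < h \<and> h \<le> c}" by auto
  have l: "a \<le> l" "l \<le> b" "l \<noteq> a \<Longrightarrow> l \<in> H" "h \<in> H \<Longrightarrow> l < h \<Longrightarrow> h \<le> b \<Longrightarrow> False" for h
  proof -
    let ?L = "{h\<in>H. a < h \<and> h \<le> b}"
    have "a \<le> l \<and> l \<le> b \<and> (l \<noteq> a \<longrightarrow> l \<in> H) \<and> (h \<in> H \<longrightarrow> l < h \<longrightarrow> h \<le> b \<longrightarrow> False)"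
    proof (cases "?L = {}")
      case False
      then have "l = Max ?L" unfolding l_def by (rule if_not_P)
      then show ?thesis using Max_in[OF fin(1) False] Max_ge[OF fin(1), of h] by fastforce
    qed (use ab in \<open>auto simp: l_def\<close>)
    then show "a \<le> l" "l \<le> b" "l \<noteq> a \<Longrightarrow> l \<in> H" "h \<in> H \<Longrightarrow> l < h \<Longrightarrow> h \<le> b \<Longrightarrow> False" by auto
  qed
  have r: "b < r" "r \<le> c + 1" "r \<noteq> c + 1 \<Longrightarrow> r \<in> H" "h \<in> H \<Longrightarrow> b < h \<Longrightarrow> h < r \<Longrightarrow> False" for h
  proof -
    let ?R = "{h\<in>H. b < h \<and> h \<le> c}"
    have "b < r \<and> r \<le> c + 1 \<and> (r \<noteq> c + 1 \<longrightarrow> r \<in> H) \<and> (h \<in> H \<longrightarrow> b < h \<longrightarrow> h < r \<longrightarrow> False)"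
    proof (cases "?R = {}")
      case False
      then have "r = Min ?R" unfolding r_def by (rule if_not_P)
      then show ?thesis using Min_in[OF fin(2) False] Min_le[OF fin(2), of h] by fastforce
    qed (use ab in \<open>auto simp: r_def\<close>)
    then show "b < r" "r \<le> c + 1" "r \<noteq> c + 1 \<Longrightarrow> r \<in> H" "h \<in> H \<Longrightarrow> b < h \<Longrightarrow> h < r \<Longrightarrow> False" by auto
  qed
  define p q where pq: "p = l - 1" "q = r - 1"
  have pl: "l = p + 1" and qr: "r = q + 1" using l r ab by (auto simp: pq)
  have "r \<noteq> b + 1" using r(3) ab b1 by auto
  then have ord: "p < b" "b < q" "q \<le> c" "a \<le> p + 1" using l r pl qr by auto
  have "g t = g l" if "p < t" "t \<le> q" for t
  proof (rule constant_between[of l q])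
    fix t assume "l < t" "t \<le> q"
    then show "g t = g (t - 1)" using l(1) r(2) r(4)[of t] qr l(4)[of t] const[of t] by force
  qed (use that pl in auto)
  then obtain A B where
    AB: "\<And>t. p \<le> t \<Longrightarrow> t \<le> q \<Longrightarrow> a \<le> t \<Longrightarrow> t < c \<Longrightarrow> cusum g a c t = A / odds a c t + B * odds a c t"
    "p + 1 = a \<Longrightarrow> A = 0" "q = c \<Longrightarrow> B = 0"
    using cusum_on_constant_piece[of a p q c g "g l"] ord ab by auto
  define z where "z = odds a c"
  have zpos: "z t > 0" if "t < c" for t using odds_pos that by (simp add: z_def)
  define P Q where PQ: "P = sg * A / z b" "Q = sg * B * z b"
  have PQG: "P + Q = G"
    using sgG AB(1)[of b] ord ab by (simp add: PQ z_def algebra_simps)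
  have at_p: "sg * cusum g a c p - G = (1 - z p / z b) * (P / (z p / z b) - Q)" if "a \<le> p"
    using AB(1)[of p] ord that ab zpos[of p] zpos[of b] unfolding PQG[symmetric] PQ
    by (simp add: z_def[symmetric] field_simps)
  have at_q: "sg * cusum g a c q - G = (1 - z b / z q) * (Q / (z b / z q) - P)" if "q < c"
    using AB(1)[of q] ord that ab zpos[of q] zpos[of b] unfolding PQG[symmetric] PQ
    by (simp add: z_def[symmetric] field_simps)
  have xp: "0 < z p / z b" "z p / z b < 1" if "a \<le> p"
    using odds_less[of a p b c] that ord ab zpos[of p] zpos[of b] by (auto simp: z_def)
  have yq: "0 < z b / z q" "z b / z q < 1" if "q < c"
    using odds_less[of a b q c] that ord ab zpos[of q] zpos[of b] by (auto simp: z_def)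
  \<comment> \<open>\<open>odds_ratio_separated\<close> yields \<open>\<rho> / 2\<close>, of which
    \<open>two_sided_gain\<close> keeps a quarter; with this value
    \<open>12 / \<kappa>\<^sup>2\<close> is the constant 768 divided by
    \<open>\<rho>\<^sup>2\<close>.\<close>
  define \<kappa> where "\<kappa> = \<rho> / 8"
  have \<kappa>: "0 < \<kappa>" "\<kappa> \<le> 1" using \<rho> by (auto simp: \<kappa>_def)
  have divG: "G \<le> G / y" if "0 < y" "y < 1" for y
    using that G by (simp add: le_divide_eq)
  \<comment> \<open>With neighbours on both sides, their separation gives the gain. With one
    neighbour, one of \<open>P\<close> and \<open>Q\<close> is zero and the other is all of
    \<open>G\<close>, so the value is simply divided by a ratio below 1. With none, \<open>G\<close>
    would be zero.\<close>
  have "(a \<le> p \<and> \<kappa> * G \<le> P / (z p / z b) - Q) \<or> (q < c \<and> \<kappa> * G \<le> Q / (z b / z q) - P)"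
  proof (cases "a \<le> p")
    case ap: True
    show ?thesis
    proof (cases "q < c")
      case qc: True
      have "p + 1 \<in> H" "q + 1 \<in> H" using l(3) r(3) ap qc pl qr by auto
      then have "\<rho> * real T \<le> real (q - p)" using sep[of "p+1" "q+1"] ord by (simp add: of_nat_diff)
      then have "z p / z q \<le> 1 - \<rho> / 2" 
        unfolding z_def using ap ord qc T \<rho> by (intro odds_ratio_separated) auto
      then have "z p / z b * (z b / z q) \<le> 1 - \<rho> / 2" using zpos[of b] ab by simp
      then show ?thesis
        using two_sided_gain[OF PQG G xp[OF ap] yq[OF qc], of "\<rho> / 2"] \<rho> ap qc by (simp add: \<kappa>_def)
    next
      case False
      then have "Q = 0" using AB(3) ord by (simp add: PQ)
      moreover have "G \<le> G / (z p / z b)" using divG xp[OF ap] by blast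
      moreover have "\<kappa> * G \<le> G" using \<kappa> G by simp
      ultimately show ?thesis using ap PQG by simp
    qed
  next
    case False
    then have "P = 0" using AB(2) ord by (simp add: PQ)
    then have "Q = G" using PQG by simp
    have qc: "q < c" using AB(3) \<open>Q = G\<close> G ord(3) by (cases "q = c") (auto simp: PQ)
    have "G \<le> G / (z b / z q)" using divG yq[OF qc] by blast
    moreover have "\<kappa> * G \<le> G" using \<kappa> G by simp
    ultimately show ?thesis using qc \<open>P = 0\<close> \<open>Q = G\<close> by simp
  qed
  then show ?thesis
  proof (elim disjE conjE)
    assume ap: "a \<le> p" and ge: "\<kappa> * G \<le> P / (z p / z b) - Q"
    have "(1 - z p / z b) * (\<kappa> * G) \<le> (1 - z p / z b) * (P / (z p / z b) - Q)"
      using ge xp[OF ap] by (intro mult_left_mono) auto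
    also have "\<dots> \<le> \<bar>cusum e a c b - cusum e a c p\<bar>" using at_p[OF ap] gain[of p] ap ord ab by simp
    also have "\<dots> \<le> \<Lambda> * sqrt (6 * (1 - z p / z b))"
      using cusum_noise_diff_bound[of a p b c \<Lambda> e] ap ord ab L noise by (simp add: e_def z_def abs_minus_commute)
    finally have "\<kappa> * G * (1 - z p / z b) \<le> \<Lambda> * sqrt (6 * (1 - z p / z b))" by (simp add: mult.commute)
    from gain_noise_tradeoff[OF this \<kappa>(1) G xp(2)[OF ap] L, of "real (b - p)" "real T"]
    have "real (b - p) \<le> 12 * real T * \<Lambda>\<^sup>2 / (\<kappa>\<^sup>2 * G\<^sup>2)"
      using odds_ratio_gap[of a p b c T] ap ord ab T by (simp add: z_def)
    also have "\<dots> = 768 * real T * \<Lambda>\<^sup>2 / (\<rho>\<^sup>2 * (cusum g a c b)\<^sup>2)"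
      by (simp add: \<kappa>_def G_def power_divide)
    finally show ?thesis using l(1,2,3) pl ap ord ab
      by (intro bexI[of _ "p+1"]) (auto simp: of_nat_diff)
  next
    assume qc: "q < c" and ge: "\<kappa> * G \<le> Q / (z b / z q) - P"
    have "(1 - z b / z q) * (\<kappa> * G) \<le> (1 - z b / z q) * (Q / (z b / z q) - P)"
      using ge yq[OF qc] by (intro mult_left_mono) auto
    also have "\<dots> \<le> \<bar>cusum e a c b - cusum e a c q\<bar>" using at_q[OF qc] gain[of q] qc ord ab by simp
    also have "\<dots> \<le> \<Lambda> * sqrt (6 * (1 - z b / z q))"
      using cusum_noise_diff_bound[of a b q c \<Lambda> e] qc ord ab L noise by (simp add: e_def z_def)
    finally have "\<kappa> * G * (1 - z b / z q) \<le> \<Lambda> * sqrt (6 * (1 - z b / z q))" by (simp add: mult.commute)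
    from gain_noise_tradeoff[OF this \<kappa>(1) G yq(2)[OF qc] L, of "real (q - b)" "real T"]
    have "real (q - b) \<le> 12 * real T * \<Lambda>\<^sup>2 / (\<kappa>\<^sup>2 * G\<^sup>2)"
      using odds_ratio_gap[of a b q c T] qc ord ab T by (simp add: z_def)
    also have "\<dots> = 768 * real T * \<Lambda>\<^sup>2 / (\<rho>\<^sup>2 * (cusum g a c b)\<^sup>2)"
      by (simp add: \<kappa>_def G_def power_divide)
    finally show ?thesis using r(1,2,3) qr qc ord ab
      by (intro bexI[of _ "q+1"]) (auto simp: of_nat_diff)
  qed
qed

section \<open>Segments with undetected change-points\<close>

text \<open>The numerator is \<open>768 * 64\<close>: 768 comes from the localization of the argmax,
  and 64 from squaring the lower bound \<open>jump * sqrt (\<delta> * T) / 8\<close> on the signal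
  CUSUM. Two powers of \<delta> stem from the spacing and one from this lower bound.\<close>

definition localization_const :: "real \<Rightarrow> real" where
  "localization_const \<delta> = 49152 / \<delta> ^ 3"

lemma bound_collapse:
  fixes J T L d :: real
  assumes "J \<noteq> 0" "T \<noteq> 0" "d \<noteq> 0"
  shows "J\<^sup>2 * (768 * T * L / (d\<^sup>2 * (J\<^sup>2 * (d * T) / 64))) = 49152 / d ^ 3 * L"
proof -
  have "J\<^sup>2 * (768 * T * L / (d\<^sup>2 * (J\<^sup>2 * (d * T) / 64))) = (J\<^sup>2 * T) * (49152 * L) / ((J\<^sup>2 * T) * d ^ 3)"
    by (simp add: power2_eq_square power3_eq_cube mult_ac)
  also have "\<dots> = 49152 / d ^ 3 * L" using assms by simp
  finally show ?thesis .
qed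

locale spaced_signal =
  fixes T :: nat and \<delta> fT :: real and x :: "nat \<Rightarrow> real"
  assumes \<delta>: "0 < \<delta>" "\<delta> \<le> 1" and fT: "0 < fT" and T_large: "24 \<le> \<delta> * real T"
begin

lemma T_pos: "0 < real T"
  using T_large by (cases T) auto

definition jump :: "(nat \<Rightarrow> real) \<Rightarrow> nat \<Rightarrow> real" where
  "jump g h = \<bar>g h - g (h - 1)\<bar>"

text \<open>\<open>g\<close> is a surrogate signal that jumps only at the points of \<open>H\<close>; what a change-point outside
  \<open>H\<close> contributes near the ends of \<open>[s, e]\<close> is counted as part of the noise \<open>x - g\<close>.\<close>
definition segment :: "real \<Rightarrow> nat \<Rightarrow> nat \<Rightarrow> nat set \<Rightarrow> (nat \<Rightarrow> real) \<Rightarrow> bool" where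
  "segment \<Lambda> s e H g \<longleftrightarrow> 1 \<le> s \<and> s \<le> e \<and> e \<le> T \<and> 0 \<le> \<Lambda>
    \<and> (\<forall>h\<in>H. \<delta> * real T / 2 \<le> real h - real s \<and> \<delta> * real T / 2 \<le> real e + 1 - real h \<and> fT \<le> jump g h)
    \<and> (\<forall>h\<in>H. \<forall>h'\<in>H. h < h' \<longrightarrow> \<delta> * real T \<le> real h' - real h)
    \<and> (\<forall>t. s < t \<longrightarrow> t \<le> e \<longrightarrow> t \<notin> H \<longrightarrow> g t = g (t - 1))
    \<and> (\<forall>l m. s \<le> l \<longrightarrow> l \<le> m \<longrightarrow> m \<le> e \<longrightarrow>
        \<bar>\<Sum>t = l..m. x t - g t\<bar> \<le> \<Lambda> * sqrt (real (m - l + 1)))"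

lemma segmentD:
  assumes "segment \<Lambda> s e H g"
  shows "1 \<le> s" "s \<le> e" "e \<le> T" "0 \<le> \<Lambda>"
    "\<And>h. h \<in> H \<Longrightarrow> \<delta> * real T / 2 \<le> real h - real s"
    "\<And>h. h \<in> H \<Longrightarrow> \<delta> * real T / 2 \<le> real e + 1 - real h"
    "\<And>h. h \<in> H \<Longrightarrow> fT \<le> jump g h"
    "\<And>h h'. h \<in> H \<Longrightarrow> h' \<in> H \<Longrightarrow> h < h' \<Longrightarrow> \<delta> * real T \<le> real h' - real h"
    "\<And>t. s < t \<Longrightarrow> t \<le> e \<Longrightarrow> t \<notin> H \<Longrightarrow> g t = g (t - 1)"
    "\<And>l m. s \<le> l \<Longrightarrow> l \<le> m \<Longrightarrow> m \<le> e \<Longrightarrow>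
        \<bar>\<Sum>t = l..m. x t - g t\<bar> \<le> \<Lambda> * sqrt (real (m - l + 1))"
  using assms unfolding segment_def by blast+

lemma segment_subset:
  assumes "segment \<Lambda> s e H g"
  shows "H \<subseteq> {s<..e}"
proof
  fix h assume "h \<in> H"
  then have "12 \<le> real h - real s" "12 \<le> real e + 1 - real h"
    using segmentD(5,6)[OF assms \<open>h \<in> H\<close>] T_large by linarith+
  then show "h \<in> {s<..e}" by auto
qed

lemma segment_finite: "segment \<Lambda> s e H g \<Longrightarrow> finite H"
  by (rule finite_subset[OF segment_subset]) auto

text \<open>The upper bounds keep all other points of a \<open>segment\<close> out of
  \<open>[a, c]\<close>, and with the margin \<open>\<delta> * T / 2\<close> they let every pair of
  offsets in the range fit into \<open>[s, e]\<close>. The lower bounds keep \<open>h\<close> away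
  from both ends, so that the CUSUM at \<open>h - 1\<close> is of order
  \<open>sqrt T\<close>.\<close>

definition isolating :: "nat \<Rightarrow> nat \<Rightarrow> nat \<Rightarrow> (nat \<times> nat) set" where
  "isolating s e h = {(a, c). s \<le> a \<and> c \<le> e
     \<and> \<delta> * real T / 8 \<le> real h - real a \<and> real h - real a \<le> \<delta> * real T / 2
     \<and> \<delta> * real T / 8 \<le> real c + 1 - real h \<and> real c + 1 - real h \<le> \<delta> * real T / 2}"

lemma isolating_bounds:
  assumes "(a, c) \<in> isolating s e h"
  shows "s \<le> a" "c \<le> e" "a + 1 < h" "h < c"
proof -
  have "3 \<le> real h - real a" "3 \<le> real c + 1 - real h" 
    using assms T_large by (auto simp: isolating_def)
  then show "a + 1 < h" "h < c" by auto
qed (use assms in \<open>auto simp: isolating_def\<close>)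

text \<open>The exact value is the jump times \<open>sqrt (u * v / (u + v))\<close>, with
  \<open>u\<close> and \<open>v\<close> the lengths of the two sides, and
  \<open>u * v / (u + v)\<close> is at least half of the shorter side.\<close>

lemma cusum_single_jump:
  assumes "a < h" "h \<le> c" and g1: "\<And>t. a \<le> t \<Longrightarrow> t < h \<Longrightarrow> g t = w1" and g2: "\<And>t. h \<le> t \<Longrightarrow> t \<le> c \<Longrightarrow> g t = w2"
    and k: "0 \<le> k" "k \<le> real h - real a" "k \<le> real c + 1 - real h"
  shows "\<bar>w2 - w1\<bar> * sqrt (k / 2) \<le> \<bar>cusum g a c (h - 1)\<bar>"
proof -
  define u v where uv: "u = real (h - a)" "v = real (c + 1 - h)"
  have pos: "u > 0" "v > 0" using assms by (auto simp: uv)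
  have k': "k \<le> u" "k \<le> v" using k assms by (auto simp: uv of_nat_diff)
  have "(\<Sum>t = a..h-1. g t) = (\<Sum>t = a..h-1. w1)" using g1 assms by (intro sum.cong) auto
  also have "\<dots> = u * w1" using assms by (simp add: uv)
  finally have s1: "(\<Sum>t = a..h-1. g t) = u * w1" .
  have "(\<Sum>t = h..c. g t) = (\<Sum>t = h..c. w2)" using g2 by (intro sum.cong) auto
  also have "\<dots> = v * w2" using assms by (simp add: uv)
  finally have s2: "(\<Sum>t = h..c. g t) = v * w2" .
  have s: "(\<Sum>t = a..c. g t) = u * w1 + v * w2"
    using sum_atLeastAtMost_split[of a "h-1" c g] assms s1 s2 by simp
  have cs: "cusum g a c (h - 1) = ((u + v) * (u * w1) - u * (u * w1 + v * w2)) / sqrt ((u + v) * u * v)"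
  proof -
    have "real (c - a + 1) = u + v" "real (h - 1 - a + 1) = u" "real (c - (h - 1)) = v"
      using assms by (auto simp: uv of_nat_diff)
    then show ?thesis using assms by (subst cusum_alt) (auto simp only: s s1)
  qed
  also have "(u + v) * (u * w1) - u * (u * w1 + v * w2) = u * v * (w1 - w2)" by (simp add: algebra_simps)
  finally have "\<bar>cusum g a c (h - 1)\<bar> = \<bar>w2 - w1\<bar> * (u * v / sqrt ((u + v) * u * v))"
    using pos by (simp add: abs_mult abs_minus_commute)
  also have "u * v / sqrt ((u + v) * u * v) = sqrt (u * v / (u + v))"
    using pos sqrt_divide_mult[of "u + v" 1 "u * v"] by (simp only: mult_1_right mult.assoc add_pos_pos mult_pos_pos zero_less_one)
  finally have e: "\<bar>cusum g a c (h - 1)\<bar> = \<bar>w2 - w1\<bar> * sqrt (u * v / (u + v))" .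
  have "k * u \<le> u * v" "k * v \<le> u * v" 
    using k' pos mult_right_mono[of k v u] mult_right_mono[of k u v] by (simp_all add: mult.commute)
  then have "k * (u + v) \<le> u * v * 2" unfolding distrib_left by linarith
  then have "k / 2 * (u + v) \<le> u * v" by linarith
  then have "k / 2 \<le> u * v / (u + v)" using pos by (subst pos_le_divide_eq) (simp_all only: add_pos_pos)
  then show ?thesis unfolding e by (intro mult_left_mono) auto
qed

lemma cusum_isolating:
  assumes seg: "segment \<Lambda> s e H g" and h: "h \<in> H" and ac: "(a, c) \<in> isolating s e h"
  shows "jump g h * sqrt (\<delta> * real T) / 4 \<le> \<bar>cusum g a c (h - 1)\<bar>"
proof -
  note ib = isolating_bounds[OF ac]
  have ac': "\<delta> * real T / 8 \<le> real h - real a" "real h - real a \<le> \<delta> * real T / 2"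
     "\<delta> * real T / 8 \<le> real c + 1 - real h" "real c + 1 - real h \<le> \<delta> * real T / 2"
    using ac by (auto simp: isolating_def)
  have only: "t = h" if "t \<in> H" "a < t" "t \<le> c" for t
  proof (rule ccontr)
    assume "t \<noteq> h"
    then consider "t < h" | "h < t" by linarith
    then show False
    proof cases
      case 1
      then have "\<delta> * real T \<le> real h - real t" using segmentD(8)[OF seg] that h by blast
      then show False using ac' that T_large by simp
    next
      case 2
      then have "\<delta> * real T \<le> real t - real h" using segmentD(8)[OF seg] that h by blast
      then show False using ac' that T_large by simp
    qed
  qed
  have step: "g t = g (t - 1)" if "a < t" "t \<le> c" "t \<noteq> h" for t
    using segmentD(9)[OF seg, of t] only that ib by auto
  have g1: "g t = g a" if "a \<le> t" "t < h" for t
    by (rule constant_between[of a t], rule step) (use that ib in auto)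
  have g2: "g t = g h" if "h \<le> t" "t \<le> c" for t
    by (rule constant_between[of h t], rule step) (use that ib in auto)
  \<comment> \<open>Both sides have length at least \<open>k = \<delta> * T / 8\<close>, and
    \<open>sqrt (k / 2)\<close> is the claimed \<open>sqrt (\<delta> * T) / 4\<close>.\<close>
  have "\<bar>g h - g a\<bar> * sqrt (\<delta> * real T / 8 / 2) \<le> \<bar>cusum g a c (h - 1)\<bar>"
    by (rule cusum_single_jump[OF _ _ g1 g2]) (use ac' ib T_large in auto)
  moreover have "g a = g (h - 1)" using g1[of "h - 1"] ib by simp
  ultimately show ?thesis by (simp add: jump_def real_sqrt_divide)
qed

lemma segment_noise_cusum:
  assumes seg: "segment \<Lambda> s e H g" and "s \<le> a" "a \<le> b" "b < c" "c \<le> e"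
  shows "\<bar>cusum x a c b - cusum g a c b\<bar> \<le> 2 * \<Lambda>"
  unfolding cusum_diff[symmetric]
  using assms segmentD(10)[OF seg] by (intro cusum_noise_bound) (auto intro: segmentD(4)[OF seg])

lemma segment_no_change_cusum:
  assumes seg: "segment \<Lambda> s e {} g" and b: "s \<le> a" "a \<le> b" "b < c" "c \<le> e"
  shows "\<bar>cusum x a c b\<bar> \<le> 2 * \<Lambda>"
proof -
  \<comment> \<open>The constant piece is all of \<open>[a, c]\<close>, that is
    \<open>p = a - 1\<close> and \<open>q = c\<close>, so both coefficients vanish; positivity of
    \<open>a\<close> makes the predecessor on naturals exact.\<close>
  have a1: "1 \<le> a" using b segmentD(1)[OF seg] by simp
  then have p: "a \<le> a - 1 + 1" "a - 1 \<le> c" "a \<le> c" using b by auto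
  have const: "g t = g s" if "a - 1 < t" "t \<le> c" for t
    by (rule constant_between[of s t], rule segmentD(9)[OF seg]) (use that b in auto)
  obtain A B where "\<And>t. a - 1 \<le> t \<Longrightarrow> t \<le> c \<Longrightarrow> a \<le> t \<Longrightarrow> t < c \<Longrightarrow> cusum g a c t = A / odds a c t + B * odds a c t"
    "a - 1 + 1 = a \<Longrightarrow> A = 0" "c = c \<Longrightarrow> B = 0"
    by (rule cusum_on_constant_piece[where y = g and w = "g s", OF p(1,2) order.refl p(3) const]) (assumption+, rule that)
  then have "cusum g a c b = 0" using b a1 by simp
  then show ?thesis using segment_noise_cusum[OF seg b] by simp
qed

lemma argmax_detects:
  assumes seg: "segment \<Lambda> s e H g" and h0: "h0 \<in> H" "\<And>h. h \<in> H \<Longrightarrow> jump g h \<le> jump g h0"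
    and I: "I \<subseteq> intervals s e" "I \<inter> isolating s e h0 \<noteq> {}"
    and small: "32 * \<Lambda> < fT * sqrt (\<delta> * real T)"
    and am: "(a, c, b) \<in> argmax_set x I"
  shows "sqrt \<delta> / 8 * fT * sqrt (real T) \<le> \<bar>cusum x a c b\<bar>"
    and "\<exists>h\<in>H. (jump g h)\<^sup>2 * \<bar>real h - 1 - real b\<bar> \<le> localization_const \<delta> * \<Lambda>\<^sup>2"
proof -
  define w where "w = sqrt (\<delta> * real T)"
  have w: "w > 0" using T_large by (simp add: w_def)
  have finI: "finite I" by (rule finite_subset[OF I(1)], rule finite_subset[of _ "{s..e} \<times> {s..e}"])
     (auto simp: intervals_def)
  have finc: "finite (candidates I)"
    by (rule finite_subset[of _ "{s..e} \<times> {s..e} \<times> {s..e}"]) (use I in \<open>auto simp: candidates_def intervals_def\<close>)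
  define st where "st = (\<lambda>r. \<bar>cusum x (fst r) (fst (snd r)) (snd (snd r))\<bar>)"
  have acb: "(a, c, b) \<in> candidates I" and stm: "st (a, c, b) = Max (st ` candidates I)"
    using am by (auto simp: argmax_set_def st_def)
  have max: "\<bar>cusum x a' c' b'\<bar> \<le> \<bar>cusum x a c b\<bar>" if "(a', c') \<in> I" "a' \<le> b'" "b' < c'" for a' c' b'
  proof -
    have "st (a', c', b') \<le> Max (st ` candidates I)"
      using finc that by (intro Max_ge) (auto simp: candidates_def)
    then show ?thesis unfolding stm[symmetric] by (simp add: st_def)
  qed
  have ac: "(a, c) \<in> I" "a \<le> b" "b < c" using acb by (auto simp: candidates_def)
  then have sace: "s \<le> a" "c \<le> e" using I(1) by (auto simp: intervals_def)
  obtain a0 c0 where i0: "(a0, c0) \<in> I" "(a0, c0) \<in> isolating s e h0" using I(2) by auto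
  note ib = isolating_bounds[OF i0(2)]
  have L: "32 * \<Lambda> < jump g h0 * w"
    using small segmentD(7)[OF seg h0(1)] w mult_right_mono[of fT "jump g h0" w] unfolding w_def by linarith
  have "jump g h0 * w / 4 - 2 * \<Lambda> \<le> \<bar>cusum x a0 c0 (h0 - 1)\<bar>"
    using cusum_isolating[OF seg h0(1) i0(2)] segment_noise_cusum[OF seg, of a0 "h0 - 1" c0] ib
    unfolding w_def by linarith
  also have "\<dots> \<le> \<bar>cusum x a c b\<bar>" using max[OF i0(1), of "h0 - 1"] ib by simp
  finally have big: "jump g h0 * w / 4 - 2 * \<Lambda> \<le> \<bar>cusum x a c b\<bar>" .
  have "fT * w / 8 \<le> jump g h0 * w / 8" using segmentD(7)[OF seg h0(1)] w by simp
  also have "\<dots> \<le> \<bar>cusum x a c b\<bar>" using big L segmentD(4)[OF seg] by linarith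
  finally show "sqrt \<delta> / 8 * fT * sqrt (real T) \<le> \<bar>cusum x a c b\<bar>"
    by (simp add: w_def real_sqrt_mult mult.commute mult.left_commute)
  \<comment> \<open>Noise is paid for twice, at the isolating interval and at the maximiser. The
    cost \<open>4 * \<Lambda>\<close> is at most half of \<open>jump g h0 * w / 4\<close>, which is
    what the factor 32 is for.\<close>
  have gbig: "jump g h0 * w / 8 \<le> \<bar>cusum g a c b\<bar>"
    using big segment_noise_cusum[OF seg sace(1) ac(2,3) sace(2)] L segmentD(4)[OF seg] by linarith
  have "\<exists>h\<in>H. a < h \<and> h \<le> c \<and>
     \<bar>real h - 1 - real b\<bar> \<le> 768 * real T * \<Lambda>\<^sup>2 / (\<delta>\<^sup>2 * (cusum g a c b)\<^sup>2)"
  proof (rule cusum_argmax_localization[where x = x])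
    show "c - a + 1 \<le> T" using sace segmentD(1,3)[OF seg] ac by simp
    show "2 * \<Lambda> < \<bar>cusum g a c b\<bar>" using gbig L segmentD(4)[OF seg] by linarith
    show "\<bar>cusum x a c b'\<bar> \<le> \<bar>cusum x a c b\<bar>" if "a \<le> b'" "b' < c" for b'
      using max ac that by blast
    show "g t = g (t - 1)" if "a < t" "t \<le> c" "t \<notin> H" for t
      using segmentD(9)[OF seg, of t] that sace by simp
    show "\<bar>\<Sum>t = l..m. x t - g t\<bar> \<le> \<Lambda> * sqrt (real (m - l + 1))" if "a \<le> l" "l \<le> m" "m \<le> c" for l m
      using segmentD(10)[OF seg, of l m] that sace by simp
    show "1 \<le> a" using segmentD(1)[OF seg] sace by simp
  qed (fact \<delta> ac(2,3) segmentD(4,8)[OF seg])+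
  then obtain h where h: "h \<in> H" "\<bar>real h - 1 - real b\<bar> \<le> 768 * real T * \<Lambda>\<^sup>2 / (\<delta>\<^sup>2 * (cusum g a c b)\<^sup>2)"
    by blast
  have j0: "0 < jump g h0" using segmentD(7)[OF seg h0(1)] fT by linarith
  have "(jump g h0 * w / 8)\<^sup>2 \<le> (cusum g a c b)\<^sup>2"
    using gbig j0 w by (subst abs_le_square_iff[symmetric]) (simp add: abs_mult)
  moreover have w2: "w\<^sup>2 = \<delta> * real T" using T_large by (simp add: w_def)
  ultimately have le: "(jump g h0)\<^sup>2 * (\<delta> * real T) / 64 \<le> (cusum g a c b)\<^sup>2" 
    by (simp add: power_mult_distrib power_divide)
  have Tpos: "real T > 0" by (rule T_pos)
  \<comment> \<open>The error is weighted with the jump at the point \<open>h\<close> that was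
    found, since this product is the energy that later moves into the noise.\<close>
  have "(jump g h)\<^sup>2 * \<bar>real h - 1 - real b\<bar> \<le> (jump g h0)\<^sup>2 * (768 * real T * \<Lambda>\<^sup>2 / (\<delta>\<^sup>2 * ((jump g h0)\<^sup>2 * (\<delta> * real T) / 64)))"
  proof (intro mult_mono)
    show "(jump g h)\<^sup>2 \<le> (jump g h0)\<^sup>2" using h0(2)[OF h(1)] by (intro power_mono) (auto simp: jump_def)
    have "768 * real T * \<Lambda>\<^sup>2 / (\<delta>\<^sup>2 * (cusum g a c b)\<^sup>2) \<le> 768 * real T * \<Lambda>\<^sup>2 / (\<delta>\<^sup>2 * ((jump g h0)\<^sup>2 * (\<delta> * real T) / 64))"
    proof (intro divide_left_mono mult_left_mono)
      have "0 < (jump g h0)\<^sup>2 * (\<delta> * real T) / 64" using j0 \<delta> Tpos by simp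
      then show "0 < \<delta>\<^sup>2 * (cusum g a c b)\<^sup>2 * (\<delta>\<^sup>2 * ((jump g h0)\<^sup>2 * (\<delta> * real T) / 64))"
        using le \<delta> by (intro mult_pos_pos) auto
    qed (use le in auto)
    then show "\<bar>real h - 1 - real b\<bar> \<le> 768 * real T * \<Lambda>\<^sup>2 / (\<delta>\<^sup>2 * ((jump g h0)\<^sup>2 * (\<delta> * real T) / 64))"
      using h(2) by linarith
  qed auto
  also have "\<dots> = localization_const \<delta> * \<Lambda>\<^sup>2"
    unfolding localization_const_def using j0 Tpos \<delta> by (intro bound_collapse) auto
  finally show "\<exists>h\<in>H. (jump g h)\<^sup>2 * \<bar>real h - 1 - real b\<bar> \<le> localization_const \<delta> * \<Lambda>\<^sup>2" using h(1) by blast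
qed

end

section \<open>Stability of the square-root law under perturbations\<close>

lemma perturbed_sum_bound:
  fixes y :: "nat \<Rightarrow> real"
  assumes y: "\<bar>\<Sum>t = l..m. y t\<bar> \<le> \<Lambda> * sqrt (real (m - l + 1))" and "0 \<le> \<Lambda>" "0 \<le> \<Gamma>" "l \<le> m"
    and I: "finite I" "d\<^sup>2 * real (card I) \<le> \<Gamma> * \<Lambda>\<^sup>2"
  shows "\<bar>\<Sum>t = l..m. y t + (if t \<in> I then d else 0)\<bar> \<le> \<Lambda> * (1 + sqrt \<Gamma>) * sqrt (real (m - l + 1))"
proof -
  define L where "L = real (m - l + 1)"
  define k where "k = card ({l..m} \<inter> I)"
  have k: "real k \<le> L" "real k \<le> real (card I)"
    using card_mono[of "{l..m}" "{l..m} \<inter> I"] card_mono[OF I(1), of "{l..m} \<inter> I"] \<open>l \<le> m\<close>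
    by (auto simp: k_def L_def of_nat_diff simp flip: of_nat_Suc)
  have "(\<Sum>t = l..m. if t \<in> I then d else 0) = real k * d"
    by (simp add: k_def sum.inter_restrict[symmetric])
  then have "\<bar>\<Sum>t = l..m. y t + (if t \<in> I then d else 0)\<bar> \<le> \<bar>\<Sum>t = l..m. y t\<bar> + real k * \<bar>d\<bar>"
    by (simp add: sum.distrib abs_mult order_trans[OF abs_triangle_ineq])
  \<comment> \<open>Cauchy-Schwarz: one factor \<open>sqrt k\<close> is bounded through the length
    of the window, the other together with \<open>d\<close> through the total energy on
    \<open>I\<close>.\<close>
  also have "real k * \<bar>d\<bar> = sqrt (real k) * (\<bar>d\<bar> * sqrt (real k))" by simp
  also have "\<dots> \<le> sqrt L * (sqrt \<Gamma> * \<Lambda>)"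
  proof (rule mult_mono)
    have "\<bar>d\<bar> * sqrt (real k) = sqrt (d\<^sup>2 * real k)" by (simp add: real_sqrt_mult)
    also have "\<dots> \<le> sqrt (d\<^sup>2 * real (card I))" using k by (intro real_sqrt_le_mono mult_left_mono) auto
    also have "\<dots> \<le> sqrt (\<Gamma> * \<Lambda>\<^sup>2)" using I by simp
    finally show "\<bar>d\<bar> * sqrt (real k) \<le> sqrt \<Gamma> * \<Lambda>" using assms by (simp add: real_sqrt_mult)
  qed (use k in auto)
  finally show ?thesis using y by (simp add: L_def algebra_simps)
qed

lemma card_nat_interval_ge:
  fixes u v :: real
  assumes "0 \<le> u" "u + 1 \<le> v"
  shows "v - u - 1 \<le> real (card {j::nat. u \<le> real j \<and> real j \<le> v})"
proof -
  have "{nat \<lceil>u\<rceil>..nat \<lfloor>v\<rfloor>} \<subseteq> {j::nat. u \<le> real j \<and> real j \<le> v}"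
    using assms by (auto simp: nat_le_iff le_nat_iff ceiling_le_iff le_floor_iff)
  moreover have "finite {j::nat. u \<le> real j \<and> real j \<le> v}"
    by (rule finite_subset[of _ "{..nat \<lfloor>v\<rfloor>}"]) (auto simp: le_nat_floor)
  ultimately have "card {nat \<lceil>u\<rceil>..nat \<lfloor>v\<rfloor>} \<le> card {j::nat. u \<le> real j \<and> real j \<le> v}"
    by (rule card_mono[rotated])
  moreover have "v - u - 1 \<le> real (card {nat \<lceil>u\<rceil>..nat \<lfloor>v\<rfloor>})"
    using assms by simp linarith
  ultimately show ?thesis by linarith
qed

section \<open>Random draws of intervals\<close>

lemma emeasure_iid_list_avoid:
  "emeasure (measure_pmf (iid_list n p)) {ys. set ys \<inter> A = {}} = emeasure (measure_pmf p) (- A) ^ n"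
proof (induction n)
  case (Suc n)
  have "emeasure (measure_pmf (bind_pmf (iid_list n p) (\<lambda>ys. return_pmf (y # ys)))) {ys. set ys \<inter> A = {}}
    = indicator (- A) y * emeasure (measure_pmf (iid_list n p)) {ys. set ys \<inter> A = {}}" for y
  proof -
    have "emeasure (measure_pmf (bind_pmf (iid_list n p) (\<lambda>ys. return_pmf (y # ys)))) {ys. set ys \<inter> A = {}}
      = (\<integral>\<^sup>+ ys. indicator (- A) y * indicator {ys. set ys \<inter> A = {}} ys \<partial>measure_pmf (iid_list n p))"
      unfolding emeasure_bind_pmf by (intro nn_integral_cong) (auto simp: indicator_def)
    then show ?thesis by (simp add: nn_integral_cmult)
  qed
  then show ?case using Suc by (simp add: emeasure_bind_pmf nn_integral_multc mult.commute)
qed auto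

lemma set_iid_list_subset:
  "ys \<in> set_pmf (iid_list n p) \<Longrightarrow> length ys = n \<and> set ys \<subseteq> set_pmf p"
  by (induction n arbitrary: ys) fastforce+

lemma finite_intervals: "finite (intervals s e)"
  by (rule finite_subset[of _ "{s..e} \<times> {s..e}"]) (auto simp: intervals_def)

lemma set_draw_intervals:
  assumes "s < e" "1 \<le> M" and I: "I \<in> set_pmf (draw_intervals M s e)"
  shows "I \<subseteq> intervals s e" "I \<noteq> {}"
proof -
  have ne: "intervals s e \<noteq> {}" using assms(1) by (auto simp: intervals_def)
  have "I \<subseteq> intervals s e \<and> I \<noteq> {}"
  proof (cases "(e - s + 1) * (e - s) \<le> 2 * M")
    case False
    then obtain ys where ys: "I = set ys" "ys \<in> set_pmf (iid_list M (pmf_of_set (intervals s e)))"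
      using I unfolding draw_intervals_def if_not_P[OF False] by auto
    then show ?thesis using set_iid_list_subset[OF ys(2)] assms(2) finite_intervals ne by auto
  qed (use I ne in \<open>simp add: draw_intervals_def\<close>)
  then show "I \<subseteq> intervals s e" "I \<noteq> {}" by auto
qed

section \<open>The two subintervals after a split\<close>

context spaced_signal begin

text \<open>Other points of \<open>H\<close> are at least \<open>\<delta> * T\<close> away from
  \<open>h\<close>, so a stretch closer than that, with no step across \<open>h\<close>, meets no
  jump.\<close>

lemma segment_no_change_between:
  assumes seg: "segment \<Lambda> s e H g" and h: "h \<in> H" and "s \<le> t0" "t0 \<le> t" "t \<le> e"
    and "h \<le> t0 \<or> t < h" "\<bar>real t0 - real h\<bar> < \<delta> * real T" "\<bar>real t - real h\<bar> < \<delta> * real T"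
  shows "g t = g t0"
proof (rule constant_between[of t0 t])
  fix i assume i: "t0 < i" "i \<le> t"
  have "i \<notin> H"
  proof
    assume "i \<in> H"
    consider "i < h" | "h < i" using assms(6) i by linarith
    then show False
    proof cases
      case 1
      then show False using segmentD(8)[OF seg \<open>i \<in> H\<close> h] assms i by linarith
    next
      case 2
      then show False using segmentD(8)[OF seg h \<open>i \<in> H\<close>] assms i by linarith
    qed
  qed
  then show "g i = g (i - 1)" using segmentD(9)[OF seg, of i] i assms by simp
qed (use assms in auto)

lemma localization_const_nonneg: "0 \<le> localization_const \<delta>"
  using \<delta> by (simp add: localization_const_def)

text \<open>The surrogate continues the level before \<open>h\<close> up to \<open>b\<close>. If
  \<open>b\<close> overshoots, the points of \<open>{h..b}\<close> carry the wrong level; there are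
  \<open>b + 1 - h\<close> of them, so \<open>loc\<close> bounds their energy. If \<open>b\<close>
  falls short, nothing is misplaced on this side.\<close>

lemma segment_left:
  assumes seg: "segment \<Lambda> s e H g" and h: "h \<in> H" and b: "s \<le> b" "b < e"
    and loc: "(jump g h)\<^sup>2 * \<bar>real h - 1 - real b\<bar> \<le> localization_const \<delta> * \<Lambda>\<^sup>2"
    and close: "\<bar>real h - 1 - real b\<bar> \<le> \<delta> * real T / 4"
  shows "segment (\<Lambda> * (1 + sqrt (localization_const \<delta>))) s b {h'\<in>H. h' < h} (\<lambda>t. if t < h then g t else g (h - 1))"
    (is "segment ?\<Lambda> s b ?H ?g")
  unfolding segment_def
proof (intro conjI ballI allI impI)
  note sd = segmentD[OF seg]
  have hs: "h \<in> {s<..e}" using segment_subset[OF seg] h by auto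
  show "1 \<le> s" "s \<le> b" "b \<le> T" "0 \<le> ?\<Lambda>" using sd(1-4) b localization_const_nonneg by auto
  {
    fix h' assume h': "h' \<in> ?H"
    then show "\<delta> * real T / 2 \<le> real h' - real s" using sd(5) by auto
    \<comment> \<open>The new end lies within \<open>\<delta> * T / 4\<close> of a point that is a
      full \<open>\<delta> * T\<close> away from \<open>h'\<close>, so the margin
      \<open>\<delta> * T / 2\<close> is restored and not merely inherited.\<close>
    have "\<delta> * real T \<le> real h - real h'" using sd(8) h' h by auto
    then show "\<delta> * real T / 2 \<le> real b + 1 - real h'" using close by linarith
    show "fT \<le> jump ?g h'" using sd(7)[of h'] h' by (auto simp: jump_def)
    fix h2 assume "h2 \<in> ?H" "h' < h2"
    then show "\<delta> * real T \<le> real h2 - real h'" using sd(8)[of h' h2] h' by auto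
  }
  show "?g t = ?g (t - 1)" if "s < t" "t \<le> b" "t \<notin> ?H" for t
  proof -
    consider "t < h" | "t = h" | "h < t" by linarith
    then show ?thesis
    proof cases
      case 1
      then show ?thesis using sd(9)[of t] that b by simp
    qed (use hs in auto)
  qed
  have const: "g t = g h" if "h \<le> t" "t \<le> b" for t
    by (rule segment_no_change_between[OF seg h]) (use that b hs close T_large in auto)
  show "\<bar>\<Sum>t = l..m. x t - ?g t\<bar> \<le> ?\<Lambda> * sqrt (real (m - l + 1))" if "s \<le> l" "l \<le> m" "m \<le> b" for l m
  proof -
    have "(\<Sum>t = l..m. x t - ?g t) = (\<Sum>t = l..m. (x t - g t) + (if t \<in> {h..b} then g h - g (h - 1) else 0))"
    proof (rule sum.cong[OF refl])
      fix t assume "t \<in> {l..m}"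
      then have "t \<le> b" using that by simp
      then show "x t - ?g t = (x t - g t) + (if t \<in> {h..b} then g h - g (h - 1) else 0)"
        using const[of t] by (cases "t < h") auto
    qed
    also have "\<bar>\<dots>\<bar> \<le> ?\<Lambda> * sqrt (real (m - l + 1))"
    proof (rule perturbed_sum_bound)
      show "\<bar>\<Sum>t = l..m. x t - g t\<bar> \<le> \<Lambda> * sqrt (real (m - l + 1))" using sd(10)[of l m] that b by simp
      have "(g h - g (h - 1))\<^sup>2 * real (card {h..b}) \<le> (jump g h)\<^sup>2 * \<bar>real h - 1 - real b\<bar>"
        by (intro mult_mono) (auto simp: jump_def)
      then show "(g h - g (h - 1))\<^sup>2 * real (card {h..b}) \<le> localization_const \<delta> * \<Lambda>\<^sup>2"
        using loc by linarith
    qed (use sd(4) localization_const_nonneg that in auto)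
    finally show ?thesis .
  qed
qed

text \<open>Mirror image of \<open>segment_left\<close>: the level after \<open>h\<close> is
  continued backwards, and the misplaced points lie strictly between \<open>b\<close> and
  \<open>h\<close>, which occurs only when \<open>b\<close> falls short of
  \<open>h - 1\<close>.\<close>

lemma segment_right:
  assumes seg: "segment \<Lambda> s e H g" and h: "h \<in> H" and b: "s \<le> b" "b < e"
    and loc: "(jump g h)\<^sup>2 * \<bar>real h - 1 - real b\<bar> \<le> localization_const \<delta> * \<Lambda>\<^sup>2"
    and close: "\<bar>real h - 1 - real b\<bar> \<le> \<delta> * real T / 4"
  shows "segment (\<Lambda> * (1 + sqrt (localization_const \<delta>))) (b + 1) e {h'\<in>H. h < h'} (\<lambda>t. if t < h then g h else g t)"
    (is "segment ?\<Lambda> (b + 1) e ?H ?g")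
  unfolding segment_def
proof (intro conjI ballI allI impI)
  note sd = segmentD[OF seg]
  have hs: "h \<in> {s<..e}" using segment_subset[OF seg] h by auto
  show "1 \<le> b + 1" "b + 1 \<le> e" "e \<le> T" "0 \<le> ?\<Lambda>" using sd(1-4) b localization_const_nonneg by auto
  {
    fix h' assume h': "h' \<in> ?H"
    then show "\<delta> * real T / 2 \<le> real e + 1 - real h'" using sd(6) by auto
    have "\<delta> * real T \<le> real h' - real h" using sd(8) h' h by auto
    then show "\<delta> * real T / 2 \<le> real h' - real (b + 1)" using close by (simp, linarith)
    show "fT \<le> jump ?g h'" using sd(7)[of h'] h' by (auto simp: jump_def split: if_splits)
    fix h2 assume "h2 \<in> ?H" "h' < h2"
    then show "\<delta> * real T \<le> real h2 - real h'" using sd(8)[of h' h2] h' by auto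
  }
  show "?g t = ?g (t - 1)" if "b + 1 < t" "t \<le> e" "t \<notin> ?H" for t
  proof -
    consider "t < h" | "t = h" | "h < t" by linarith
    then show ?thesis
    proof cases
      case 3
      then show ?thesis using sd(9)[of t] that b by auto
    qed (use hs in auto)
  qed
  have const: "g t = g (h - 1)" if "b < t" "t < h" for t
  proof -
    have "g (h - 1) = g t"
      by (rule segment_no_change_between[OF seg h]) (use that b hs close T_large in \<open>auto simp: of_nat_diff\<close>)
    then show ?thesis by simp
  qed
  show "\<bar>\<Sum>t = l..m. x t - ?g t\<bar> \<le> ?\<Lambda> * sqrt (real (m - l + 1))" if "b + 1 \<le> l" "l \<le> m" "m \<le> e" for l m
  proof -
    have "(\<Sum>t = l..m. x t - ?g t) = (\<Sum>t = l..m. (x t - g t) + (if t \<in> {b<..<h} then g (h - 1) - g h else 0))"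
    proof (rule sum.cong[OF refl])
      fix t assume "t \<in> {l..m}"
      then have "b < t" using that by simp
      then show "x t - ?g t = (x t - g t) + (if t \<in> {b<..<h} then g (h - 1) - g h else 0)"
        using const[of t] by (cases "t < h") auto
    qed
    also have "\<bar>\<dots>\<bar> \<le> ?\<Lambda> * sqrt (real (m - l + 1))"
    proof (rule perturbed_sum_bound)
      show "\<bar>\<Sum>t = l..m. x t - g t\<bar> \<le> \<Lambda> * sqrt (real (m - l + 1))" using sd(10)[of l m] that b by simp
      have "(g (h - 1) - g h)\<^sup>2 * real (card {b<..<h}) \<le> (jump g h)\<^sup>2 * \<bar>real h - 1 - real b\<bar>"
        by (intro mult_mono) (auto simp: jump_def power2_commute[of "g h"])
      then show "(g (h - 1) - g h)\<^sup>2 * real (card {b<..<h}) \<le> localization_const \<delta> * \<Lambda>\<^sup>2"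
        using loc by linarith
    qed (use sd(4) localization_const_nonneg that in auto)
    finally show ?thesis .
  qed
qed

section \<open>Probability of missing every isolating interval\<close>

lemma card_isolating:
  assumes seg: "segment \<Lambda> s e H g" and h: "h \<in> H"
  shows "isolating s e h \<subseteq> intervals s e" "\<delta>\<^sup>2 / 9 * (real T)\<^sup>2 \<le> real (card (isolating s e h))"
proof -
  show sub: "isolating s e h \<subseteq> intervals s e"
    using isolating_bounds[of _ _ s e h] by (fastforce simp: intervals_def)
  define J where "J = {j::nat. \<delta> * real T / 8 \<le> real j \<and> real j \<le> \<delta> * real T / 2}"
  have "\<delta> * real T / 2 - \<delta> * real T / 8 - 1 \<le> real (card J)"
    unfolding J_def using T_large by (intro card_nat_interval_ge) auto
  \<comment> \<open>Since \<open>3 / 8 - 1 / 3 = 1 / 24\<close>, the lower bound 24 on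
    \<open>\<delta> * T\<close> absorbs the rounding loss of 1. Squaring the 3 gives the 9 in the
    failure probability.\<close>
  then have J: "\<delta> * real T / 3 \<le> real (card J)" using T_large by linarith
  \<comment> \<open>The pair \<open>(j, i)\<close> holds the lengths \<open>h - a\<close> and
    \<open>c + 1 - h\<close> of the two sides, which vary independently over
    \<open>J\<close>.\<close>
  define f where "f = (\<lambda>(j, i). (h - j, h - 1 + i))"
  have jh: "real j \<le> real h - real s" if "j \<in> J" for j
    using segmentD(5)[OF seg h] that unfolding J_def by auto
  have jh': "j \<le> h" if "j \<in> J" for j using jh[OF that] by linarith
  have "inj_on f (J \<times> J)" using jh' by (auto simp: inj_on_def f_def) (metis diff_diff_cancel)
  moreover have "f ` (J \<times> J) \<subseteq> isolating s e h"
  proof clarify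
    fix a c j i assume eq: "(a, c) = f (j, i)" and ji: "j \<in> J" "i \<in> J"
    have "0 < h" using segment_subset[OF seg] h by auto
    then have "real a = real h - real j" "real c + 1 = real h + real i"
      using eq jh'[OF ji(1)] by (auto simp: f_def of_nat_diff)
    moreover have "real i \<le> real e + 1 - real h" using segmentD(6)[OF seg h] ji(2) unfolding J_def by auto
    ultimately show "(a, c) \<in> isolating s e h" using jh[OF ji(1)] ji by (auto simp: isolating_def J_def)
  qed
  ultimately have "card (J \<times> J) \<le> card (isolating s e h)"
    by (rule card_inj_on_le) (rule finite_subset[OF sub finite_intervals])
  then have "real (card J * card J) \<le> real (card (isolating s e h))"
    unfolding card_cartesian_product by (rule of_nat_mono)
  then have "(real (card J))\<^sup>2 \<le> real (card (isolating s e h))"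
    by (simp only: power2_eq_square of_nat_mult)
  moreover have "(\<delta> * real T / 3)\<^sup>2 \<le> (real (card J))\<^sup>2" using J T_large by (intro power_mono) auto
  ultimately have "(\<delta> * real T / 3)\<^sup>2 \<le> real (card (isolating s e h))" by linarith
  then show "\<delta>\<^sup>2 / 9 * (real T)\<^sup>2 \<le> real (card (isolating s e h))" 
    by (simp add: power_mult_distrib power_divide)
qed

lemma draw_misses:
  assumes seg: "segment \<Lambda> s e H g" and h: "h \<in> H"
  shows "measure_pmf.prob (draw_intervals M s e) {I. I \<inter> isolating s e h = {}} \<le> (1 - \<delta>\<^sup>2 / 9) ^ M"
proof -
  let ?A = "isolating s e h"
  note sub = card_isolating(1)[OF seg h] and crd = card_isolating(2)[OF seg h]
  have pos: "0 < \<delta>\<^sup>2 / 9 * (real T)\<^sup>2" using T_pos \<delta> by simp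
  then have "?A \<noteq> {}" using crd by (metis card.empty not_le of_nat_0)
  then have ne: "intervals s e \<noteq> {}" using sub by auto
  have d9: "0 \<le> 1 - \<delta>\<^sup>2 / 9" using \<delta> power_le_one[of \<delta> 2] by simp
  show ?thesis
  proof (cases "(e - s + 1) * (e - s) \<le> 2 * M")
    case True
    then show ?thesis using \<open>?A \<noteq> {}\<close> sub d9 by (simp add: draw_intervals_def Int_absorb1)
  next
    case False
    let ?p = "pmf_of_set (intervals s e)"
    \<comment> \<open>The crude count \<open>T * T\<close> of all intervals suffices: a single
      uniform draw is isolating with probability at least
      \<open>\<delta>\<^sup>2 / 9\<close>.\<close>
    have "card (intervals s e) \<le> card ({1..T} \<times> {1..T})"
      using segmentD(1,3)[OF seg] by (intro card_mono) (auto simp: intervals_def)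
    then have "real (card (intervals s e)) \<le> real (T * T)" by (simp only: card_cartesian_product card_atLeastAtMost of_nat_le_iff) simp
    then have cI: "real (card (intervals s e)) \<le> (real T)\<^sup>2" by (simp add: power2_eq_square)
    have c0: "0 < real (card (intervals s e))" using ne finite_intervals by (simp add: card_gt_0_iff)
    have "measure_pmf.prob ?p ?A = real (card ?A) / real (card (intervals s e))"
      using ne finite_intervals sub by (simp add: measure_pmf_of_set Int_absorb1)
    moreover have "\<delta>\<^sup>2 / 9 * real (card (intervals s e)) \<le> real (card ?A)"
      using crd mult_left_mono[OF cI, of "\<delta>\<^sup>2 / 9"] by simp
    ultimately have "\<delta>\<^sup>2 / 9 \<le> measure_pmf.prob ?p ?A" using c0 by (simp add: pos_le_divide_eq)
    then have miss: "measure_pmf.prob ?p (- ?A) \<le> 1 - \<delta>\<^sup>2 / 9"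
      using measure_pmf.prob_compl[of ?A ?p] by (simp add: Compl_eq_Diff_UNIV)
    have "emeasure (measure_pmf (iid_list M ?p)) {ys. set ys \<inter> ?A = {}} = ennreal (measure_pmf.prob ?p (- ?A) ^ M)"
      unfolding emeasure_iid_list_avoid by (simp add: measure_pmf.emeasure_eq_measure ennreal_power)
    then have "measure_pmf.prob (iid_list M ?p) {ys. set ys \<inter> ?A = {}} = measure_pmf.prob ?p (- ?A) ^ M"
      by (simp add: measure_pmf.emeasure_eq_measure)
    also have "\<dots> \<le> (1 - \<delta>\<^sup>2 / 9) ^ M" using miss by (intro power_mono) auto
    finally show ?thesis using False by (simp add: draw_intervals_def measure_map_pmf vimage_def)
  qed
qed

end

section \<open>Failure probability of the recursion\<close>

text \<open>Conditional union bound over two stages of the algorithm. Restricting the second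
  hypothesis to the support of \<open>p\<close> lets facts that hold for every possible draw
  enter.\<close>

lemma prob_bind_pmf_le:
  assumes p: "measure_pmf.prob p (- S) \<le> \<epsilon>1" and f: "\<And>y. y \<in> set_pmf p \<Longrightarrow> y \<in> S \<Longrightarrow> measure_pmf.prob (f y) X \<le> \<epsilon>2"
    and "0 \<le> \<epsilon>2"
  shows "measure_pmf.prob (bind_pmf p f) X \<le> \<epsilon>1 + \<epsilon>2"
proof -
  have \<epsilon>1: "0 \<le> \<epsilon>1" using p measure_nonneg order_trans by blast
  have "emeasure (measure_pmf (bind_pmf p f)) X = (\<integral>\<^sup>+ y. emeasure (measure_pmf (f y)) X \<partial>measure_pmf p)"
    by (rule emeasure_bind_pmf)
  also have "\<dots> \<le> (\<integral>\<^sup>+ y. indicator (- S) y + ennreal \<epsilon>2 \<partial>measure_pmf p)"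
  proof (rule nn_integral_mono_AE, rule AE_pmfI)
    fix y assume y: "y \<in> set_pmf p"
    show "emeasure (measure_pmf (f y)) X \<le> indicator (- S) y + ennreal \<epsilon>2"
    proof (cases "y \<in> S")
      case True
      then show ?thesis using f[OF y True] by (simp add: measure_pmf.emeasure_eq_measure ennreal_leI)
    next
      case False
      then show ?thesis using measure_pmf.emeasure_le_1[of "f y" X] by (simp add: add_increasing2)
    qed
  qed
  also have "\<dots> = ennreal (measure_pmf.prob p (- S)) + ennreal \<epsilon>2"
    by (simp add: nn_integral_add measure_pmf.emeasure_eq_measure)
  also have "\<dots> \<le> ennreal (\<epsilon>1 + \<epsilon>2)"
    using p assms(3) \<epsilon>1 by (simp add: ennreal_leI flip: ennreal_plus)
  finally show ?thesis using \<epsilon>1 assms(3) by (simp add: measure_pmf.emeasure_eq_measure del: ennreal_plus)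
qed

lemma argmax_set_props:
  assumes "I \<subseteq> intervals s e" "I \<noteq> {}"
  shows "finite (argmax_set x I)" "argmax_set x I \<noteq> {}"
    "\<And>a c b. (a, c, b) \<in> argmax_set x I \<Longrightarrow> s \<le> a \<and> a \<le> b \<and> b < c \<and> c \<le> e"
proof -
  have fin: "finite (candidates I)"
    by (rule finite_subset[of _ "{s..e} \<times> {s..e} \<times> {s..e}"]) (use assms in \<open>auto simp: candidates_def intervals_def\<close>)
  obtain a c where "(a, c) \<in> I" using assms by auto
  then have "(a, c, a) \<in> candidates I" using assms by (auto simp: candidates_def intervals_def)
  then have ne: "candidates I \<noteq> {}" by auto
  let ?st = "\<lambda>r'. \<bar>cusum x (fst r') (fst (snd r')) (snd (snd r'))\<bar>"
  have "Max (?st ` candidates I) \<in> ?st ` candidates I" using fin ne by (intro Max_in) auto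
  then show "argmax_set x I \<noteq> {}" unfolding argmax_set_def by force
  show "finite (argmax_set x I)" unfolding argmax_set_def using fin by simp
  show "s \<le> a \<and> a \<le> b \<and> b < c \<and> c \<le> e" if "(a, c, b) \<in> argmax_set x I" for a c b
    using that assms(1) by (auto simp: argmax_set_def candidates_def intervals_def)
qed

text \<open>Wherever the splits fall, the count is \<open>1 + (b - s) + (e - b - 1) = e - s\<close>.
  The clause on records covers every outcome and so controls all CUSUMs that can arise once no
  change-point is left.\<close>

lemma wbs2_rec_records:
  assumes "1 \<le> M" "P \<in> set_pmf (wbs2_rec k x M s e)"
  shows "(e - s \<le> k \<longrightarrow> length P = e - s) \<and>
    (\<forall>r\<in>set P. \<exists>a c b. s \<le> a \<and> a \<le> b \<and> b < c \<and> c \<le> e \<and> r = (a, c, b, \<bar>cusum x a c b\<bar>))"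
  using assms(2)
proof (induction k arbitrary: s e P)
  case (Suc k)
  show ?case
  proof (cases "e \<le> s")
    case False
    then obtain I a c b L R where I: "I \<in> set_pmf (draw_intervals M s e)"
      and acb: "(a, c, b) \<in> set_pmf (pmf_of_set (argmax_set x I))"
      and L: "L \<in> set_pmf (wbs2_rec k x M s b)" and R: "R \<in> set_pmf (wbs2_rec k x M (b + 1) e)"
      and P: "P = (a, c, b, \<bar>cusum x a c b\<bar>) # L @ R"
      using Suc.prems by (auto split: prod.splits)
    have "s < e" using False by simp
    note Ip = set_draw_intervals[OF this \<open>1 \<le> M\<close> I]
    note am = argmax_set_props[OF Ip, where x = x]
    have b: "s \<le> a" "a \<le> b" "b < c" "c \<le> e" using am(3)[of a c b] acb am(1,2) by auto
    note IL = Suc.IH[OF L] and IR = Suc.IH[OF R]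
    have "\<exists>a' c' b'. s \<le> a' \<and> a' \<le> b' \<and> b' < c' \<and> c' \<le> e \<and> r = (a', c', b', \<bar>cusum x a' c' b'\<bar>)"
      if r: "r \<in> set P" for r
    proof -
      consider "r = (a, c, b, \<bar>cusum x a c b\<bar>)" | "r \<in> set L" | "r \<in> set R" using r P by auto
      then show ?thesis
      proof cases
        case 1
        then show ?thesis using b by blast
      next
        case 2
        then obtain a' c' b' where "s \<le> a'" "a' \<le> b'" "b' < c'" "c' \<le> b" "r = (a', c', b', \<bar>cusum x a' c' b'\<bar>)"
          using IL by blast
        then show ?thesis using b by (intro exI[of _ a'] exI[of _ c'] exI[of _ b']) auto
      next
        case 3
        then obtain a' c' b' where "b + 1 \<le> a'" "a' \<le> b'" "b' < c'" "c' \<le> e" "r = (a', c', b', \<bar>cusum x a' c' b'\<bar>)"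
          using IR by blast
        then show ?thesis using b by (intro exI[of _ a'] exI[of _ c'] exI[of _ b']) auto
      qed
    qed
    moreover have "length P = e - s" if "e - s \<le> Suc k"
      using that IL IR b P by auto
    ultimately show ?thesis by blast
  qed (use Suc.prems in auto)
qed auto

text \<open>Multisets make the predicate insensitive to the order in which the recursion emits its
  records and to the final sort; only \<open>P1\<close> is ordered, along the change-points. The
  ideal split for \<open>h\<close> is \<open>h - 1\<close>, the last time before the jump.\<close>

definition detects :: "real \<Rightarrow> real \<Rightarrow> real \<Rightarrow> nat set \<Rightarrow> wbs_rec list \<Rightarrow> bool" where
  "detects R hi lo H P \<longleftrightarrow> (\<exists>P1 P2. mset P = mset P1 + mset P2
     \<and> list_all2 (\<lambda>r h. \<bar>real h - 1 - real (rec_b r)\<bar> \<le> R \<and> hi \<le> rec_stat r) P1 (sorted_list_of_set H)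
     \<and> (\<forall>r\<in>set P2. rec_stat r \<le> lo))"

lemma detects_empty: "detects R hi lo {} P \<longleftrightarrow> (\<forall>r\<in>set P. rec_stat r \<le> lo)"
proof -
  have "(\<exists>P2. mset P = mset P2 \<and> (\<forall>r\<in>set P2. rec_stat r \<le> lo)) \<longleftrightarrow> (\<forall>r\<in>set P. rec_stat r \<le> lo)"
    by (metis mset_eq_setD)
  then show ?thesis by (simp add: detects_def)
qed

lemma sorted_list_of_set_split:
  fixes h :: nat
  assumes "finite H" "h \<in> H"
  shows "sorted_list_of_set H = sorted_list_of_set {h'\<in>H. h' < h} @ h # sorted_list_of_set {h'\<in>H. h < h'}"
proof (rule sorted_distinct_set_unique)
  show "set (sorted_list_of_set H) = set (sorted_list_of_set {h'\<in>H. h' < h} @ h # sorted_list_of_set {h'\<in>H. h < h'})"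
    using assms by auto
qed (use assms in \<open>auto simp: sorted_append\<close>)

lemma detects_combine:
  assumes "finite H" "h \<in> H" and L: "detects R hi lo {h'\<in>H. h' < h} L" and Q: "detects R hi lo {h'\<in>H. h < h'} Q"
    and r: "\<bar>real h - 1 - real (rec_b r)\<bar> \<le> R" "hi \<le> rec_stat r"
  shows "detects R hi lo H (r # L @ Q)"
proof -
  obtain L1 L2 where L12: "mset L = mset L1 + mset L2" "\<forall>r\<in>set L2. rec_stat r \<le> lo"
    "list_all2 (\<lambda>r h. \<bar>real h - 1 - real (rec_b r)\<bar> \<le> R \<and> hi \<le> rec_stat r) L1 (sorted_list_of_set {h'\<in>H. h' < h})"
    using L unfolding detects_def by blast
  obtain Q1 Q2 where Q12: "mset Q = mset Q1 + mset Q2" "\<forall>r\<in>set Q2. rec_stat r \<le> lo"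
    "list_all2 (\<lambda>r h. \<bar>real h - 1 - real (rec_b r)\<bar> \<le> R \<and> hi \<le> rec_stat r) Q1 (sorted_list_of_set {h'\<in>H. h < h'})"
    using Q unfolding detects_def by blast
  show ?thesis
    unfolding detects_def sorted_list_of_set_split[OF assms(1,2)]
    by (rule exI[of _ "L1 @ r # Q1"], rule exI[of _ "L2 @ Q2"])
       (use L12 Q12 r in \<open>auto intro!: list_all2_appendI\<close>)
qed

context spaced_signal begin

text \<open>The product \<open>\<Lambda> * (1 + sqrt (localization_const \<delta>)) ^ card H\<close>
  is a noise budget: a split multiplies \<Lambda> by the base, while each side has at least one
  point fewer, so the budget never exceeds its initial bound. The remaining
  \<open>card H - 1\<close> points are shared between the two sides, which makes the failure bound
  additive.\<close>

lemma wbs2_rec_detects: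
  assumes M: "1 \<le> M" and small: "32 * \<Lambda>\<^sub>m < fT * sqrt (\<delta> * real T)"
    and R: "localization_const \<delta> * \<Lambda>\<^sub>m\<^sup>2 \<le> fT\<^sup>2 * R" "R \<le> \<delta> * real T / 4"
    and seg: "segment \<Lambda> s e H g" "e - s \<le> k"
    and \<Lambda>: "\<Lambda> * (1 + sqrt (localization_const \<delta>)) ^ card H \<le> \<Lambda>\<^sub>m"
  shows "measure_pmf.prob (wbs2_rec k x M s e)
     {P. \<not> detects R (sqrt \<delta> / 8 * fT * sqrt (real T)) (2 * \<Lambda>\<^sub>m) H P} \<le> real (card H) * (1 - \<delta>\<^sup>2 / 9) ^ M"
  using seg \<Lambda>
proof (induction k arbitrary: \<Lambda> s e H g)
  case 0
  then have "H = {}" using segment_subset[OF 0(1)] by auto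
  then show ?case by (simp add: detects_empty)
next
  case (Suc k)
  note seg = Suc.prems(1)
  note fin = segment_finite[OF seg]
  define \<theta> where "\<theta> = 1 + sqrt (localization_const \<delta>)"
  define q where "q = (1 - \<delta>\<^sup>2 / 9) ^ M"
  define hi where "hi = sqrt \<delta> / 8 * fT * sqrt (real T)"
  have q: "0 \<le> q" unfolding q_def using \<delta> power_le_one[of \<delta> 2] by (intro zero_le_power) simp
  have \<theta>: "1 \<le> \<theta>" using localization_const_nonneg by (simp add: \<theta>_def)
  have \<Lambda>0: "0 \<le> \<Lambda>" by (rule segmentD(4)[OF seg])
  have "\<Lambda> * 1 \<le> \<Lambda> * \<theta> ^ card H" using \<theta> \<Lambda>0 by (intro mult_left_mono one_le_power) auto
  then have \<Lambda>m: "\<Lambda> \<le> \<Lambda>\<^sub>m" using Suc.prems(3) by (simp add: \<theta>_def)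
  show ?case
  proof (cases "H = {}")
    case True
    \<comment> \<open>Without undetected change-points every possible record is small, so failure
      has probability 0 whatever is drawn, and the recursion need not be unfolded.\<close>
    have "detects R hi (2 * \<Lambda>\<^sub>m) H P" if P: "P \<in> set_pmf (wbs2_rec (Suc k) x M s e)" for P
      unfolding True detects_empty
    proof
      fix r assume "r \<in> set P"
      then obtain a c b where "s \<le> a" "a \<le> b" "b < c" "c \<le> e" "r = (a, c, b, \<bar>cusum x a c b\<bar>)"
        using wbs2_rec_records[OF M P] by blast
      then show "rec_stat r \<le> 2 * \<Lambda>\<^sub>m"
        using segment_no_change_cusum[of \<Lambda> s e g a b c] seg \<Lambda>m unfolding True by (simp add: rec_stat_def)
    qed
    then have "measure_pmf.prob (wbs2_rec (Suc k) x M s e) {P. \<not> detects R hi (2 * \<Lambda>\<^sub>m) H P} = 0"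
      by (subst measure_pmf_zero_iff) (auto simp del: wbs2_rec.simps)
    then show ?thesis unfolding hi_def using True by simp
  next
    case False
    let ?J = "jump g ` H"
    obtain h0 where h0: "h0 \<in> H" "\<And>h. h \<in> H \<Longrightarrow> jump g h \<le> jump g h0"
      using Max_in[of ?J] Max_ge[of ?J] fin False by fastforce
    have se: "s < e" using segment_subset[OF seg] h0(1) by auto
    let ?bad = "\<lambda>H. {P. \<not> detects R hi (2 * \<Lambda>\<^sub>m) H P}"
    define body where "body = (\<lambda>I. bind_pmf (pmf_of_set (argmax_set x I)) (\<lambda>(a, c, b).
           bind_pmf (wbs2_rec k x M s b) (\<lambda>L.
           bind_pmf (wbs2_rec k x M (b + 1) e) (\<lambda>R.
           return_pmf ((a, c, b, \<bar>cusum x a c b\<bar>) # L @ R)))))"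
    have "measure_pmf.prob (bind_pmf (draw_intervals M s e) body) (?bad H) \<le> q + real (card H - 1) * q"
    proof (rule prob_bind_pmf_le)
      show "measure_pmf.prob (draw_intervals M s e) (- {I. I \<inter> isolating s e h0 \<noteq> {}}) \<le> q"
        using draw_misses[OF seg h0(1), of M] by (simp add: q_def Collect_neg_eq[symmetric])
      fix I assume "I \<in> set_pmf (draw_intervals M s e)" and "I \<in> {I. I \<inter> isolating s e h0 \<noteq> {}}"
      then have I: "I \<subseteq> intervals s e" "I \<noteq> {}" "I \<inter> isolating s e h0 \<noteq> {}"
        using set_draw_intervals[OF se M] by auto
      note am = argmax_set_props[OF I(1,2), where x = x]
      \<comment> \<open>Breaking ties costs no probability: \<open>argmax_detects\<close> applies to
        every element of the argmax set, hence \<open>S = UNIV\<close> and the leading 0.\<close>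
      have "measure_pmf.prob (body I) (?bad H) \<le> 0 + real (card H - 1) * q"
        unfolding body_def
      proof (rule prob_bind_pmf_le[where S = UNIV])
        fix acb assume "acb \<in> set_pmf (pmf_of_set (argmax_set x I))"
        moreover obtain a c b where acb: "acb = (a, c, b)" by (cases acb)
        ultimately have inam: "(a, c, b) \<in> argmax_set x I" using am(1,2) by simp
        note b = am(3)[OF inam]
        have sm: "32 * \<Lambda> < fT * sqrt (\<delta> * real T)" using small \<Lambda>m by simp
        note det = argmax_detects[OF seg h0 I(1,3) sm inam]
        obtain h where h: "h \<in> H" "(jump g h)\<^sup>2 * \<bar>real h - 1 - real b\<bar> \<le> localization_const \<delta> * \<Lambda>\<^sup>2"
          using det(2) by blast
        have "fT\<^sup>2 * \<bar>real h - 1 - real b\<bar> \<le> (jump g h)\<^sup>2 * \<bar>real h - 1 - real b\<bar>"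
          using segmentD(7)[OF seg h(1)] fT by (intro mult_right_mono power_mono) auto
        also have "\<dots> \<le> localization_const \<delta> * \<Lambda>\<^sub>m\<^sup>2"
          using h(2) \<Lambda>m \<Lambda>0 localization_const_nonneg 
            mult_left_mono[of "\<Lambda>\<^sup>2" "\<Lambda>\<^sub>m\<^sup>2" "localization_const \<delta>"] power_mono[of \<Lambda> "\<Lambda>\<^sub>m" 2] by linarith
        also have "\<dots> \<le> fT\<^sup>2 * R" by (rule R)
        \<comment> \<open>The error weighted by the jump becomes one radius for all points, because
          every jump is at least \<open>fT\<close>.\<close>
        finally have hb: "\<bar>real h - 1 - real b\<bar> \<le> R" using fT by simp
        let ?l = "{h'\<in>H. h' < h}" and ?r = "{h'\<in>H. h < h'}"
        have "H = insert h (?l \<union> ?r)" using h(1) by auto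
        also have "card \<dots> = Suc (card ?l + card ?r)" using fin by (subst card_insert_disjoint) (auto intro!: card_Un_disjoint)
        finally have cH: "card H = Suc (card ?l + card ?r)" .
        have step: "\<Lambda> * \<theta> * \<theta> ^ n \<le> \<Lambda>\<^sub>m" if "Suc n \<le> card H" for n
        proof -
          have "\<Lambda> * (\<theta> ^ Suc n) \<le> \<Lambda> * \<theta> ^ card H" 
            using \<theta> \<Lambda>0 that by (intro mult_left_mono power_increasing) auto
          then show ?thesis using Suc.prems(3) by (simp add: \<theta>_def mult.assoc)
        qed
        have close: "\<bar>real h - 1 - real b\<bar> \<le> \<delta> * real T / 4" using hb R(2) by linarith
        have sb: "s \<le> b" "b < e" using b by auto
        note left = segment_left[OF seg h(1) sb h(2) close, folded \<theta>_def]
        note right = segment_right[OF seg h(1) sb h(2) close, folded \<theta>_def]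
        have "measure_pmf.prob (wbs2_rec k x M s b) (?bad ?l) \<le> real (card ?l) * q"
          unfolding hi_def q_def
          by (rule Suc.IH[OF left]) (use sb Suc.prems(2) step[of "card ?l"] cH in \<open>auto simp: \<theta>_def\<close>)
        then have PL: "measure_pmf.prob (wbs2_rec k x M s b) (- {P. detects R hi (2 * \<Lambda>\<^sub>m) ?l P}) \<le> real (card ?l) * q"
          by (simp add: Collect_neg_eq)
        have "measure_pmf.prob (wbs2_rec k x M (b + 1) e) (?bad ?r) \<le> real (card ?r) * q"
          unfolding hi_def q_def
          by (rule Suc.IH[OF right]) (use sb Suc.prems(2) step[of "card ?r"] cH in \<open>auto simp: \<theta>_def\<close>)
        then have PR: "measure_pmf.prob (wbs2_rec k x M (b + 1) e) (- {P. detects R hi (2 * \<Lambda>\<^sub>m) ?r P}) \<le> real (card ?r) * q"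
          by (simp add: Collect_neg_eq)
        have "measure_pmf.prob (bind_pmf (wbs2_rec k x M s b) (\<lambda>L. bind_pmf (wbs2_rec k x M (b + 1) e) (\<lambda>R.
           return_pmf ((a, c, b, \<bar>cusum x a c b\<bar>) # L @ R)))) (?bad H) \<le> real (card ?l) * q + (real (card ?r) * q + 0)"
        proof (rule prob_bind_pmf_le[OF PL], rule prob_bind_pmf_le[OF PR])
          fix L Q assume "L \<in> {P. detects R hi (2 * \<Lambda>\<^sub>m) ?l P}" "Q \<in> {P. detects R hi (2 * \<Lambda>\<^sub>m) ?r P}"
          then have "detects R hi (2 * \<Lambda>\<^sub>m) H ((a, c, b, \<bar>cusum x a c b\<bar>) # L @ Q)"
            using hb det(1) by (intro detects_combine[OF fin h(1)]) (auto simp: rec_b_def rec_stat_def hi_def)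
          then show "measure_pmf.prob (return_pmf ((a, c, b, \<bar>cusum x a c b\<bar>) # L @ Q)) (?bad H) \<le> 0"
            by simp
        qed (use q in auto)
        also have "\<dots> = real (card H - 1) * q" by (simp add: cH algebra_simps)
        finally show "measure_pmf.prob (case acb of (a, c, b) \<Rightarrow> bind_pmf (wbs2_rec k x M s b) (\<lambda>L.
           bind_pmf (wbs2_rec k x M (b + 1) e) (\<lambda>R. return_pmf ((a, c, b, \<bar>cusum x a c b\<bar>) # L @ R)))) (?bad H)
           \<le> real (card H - 1) * q" by (simp add: acb)
      qed (use q in auto)
      then show "measure_pmf.prob (body I) (?bad H) \<le> real (card H - 1) * q" by simp
    qed (use q in auto)
    moreover have "card H \<ge> 1" using False fin by (simp add: Suc_le_eq card_gt_0_iff)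
    ultimately show ?thesis using se unfolding body_def hi_def q_def 
      by (simp add: of_nat_diff algebra_simps)
  qed
qed

end

section \<open>The sorted path\<close>

lemma sorted_desc_filter_split:
  fixes f :: "'a \<Rightarrow> real"
  assumes "sorted_wrt (\<lambda>u v. f v \<le> f u) ys"
  shows "ys = filter (\<lambda>r. c \<le> f r) ys @ filter (\<lambda>r. \<not> c \<le> f r) ys"
  using assms
proof (induction ys)
  case (Cons y ys)
  show ?case
  proof (cases "c \<le> f y")
    case False
    then have "filter (\<lambda>r. c \<le> f r) ys = []" using Cons.prems by (auto simp: filter_empty_conv)
    then show ?thesis using False Cons by simp
  qed (use Cons in auto)
qed simp

text \<open>As \<open>lo < hi\<close>, the threshold \<open>hi\<close> separates \<open>P1\<close>
  from \<open>P2\<close>, and in a descending list the entries above a threshold form a prefix, here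
  of length \<open>card H\<close>.\<close>

lemma detects_take_drop:
  assumes "detects R hi lo H P" "lo < hi" and ys: "mset ys = mset P" "sorted_wrt (\<lambda>u v. rec_stat v \<le> rec_stat u) ys"
  obtains P1 where "mset (take (card H) ys) = mset P1"
    "list_all2 (\<lambda>r h. \<bar>real h - 1 - real (rec_b r)\<bar> \<le> R \<and> hi \<le> rec_stat r) P1 (sorted_list_of_set H)"
    "\<And>r. r \<in> set (drop (card H) ys) \<Longrightarrow> rec_stat r \<le> lo"
proof -
  obtain P1 P2 where P: "mset P = mset P1 + mset P2" "\<forall>r\<in>set P2. rec_stat r \<le> lo"
    and P1: "list_all2 (\<lambda>r h. \<bar>real h - 1 - real (rec_b r)\<bar> \<le> R \<and> hi \<le> rec_stat r) P1 (sorted_list_of_set H)"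
    using assms(1) unfolding detects_def by blast
  have P1hi: "hi \<le> rec_stat r" if "r \<in> set P1" for r
    using P1 that by (auto simp: list_all2_conv_all_nth in_set_conv_nth)
  let ?Q = "\<lambda>r. hi \<le> rec_stat r"
  have "filter ?Q P1 = P1" "filter ?Q P2 = []" "filter (\<lambda>r. \<not> ?Q r) P1 = []" "filter (\<lambda>r. \<not> ?Q r) P2 = P2"
    using P1hi P(2) \<open>lo < hi\<close> by (fastforce simp: filter_id_conv filter_empty_conv)+
  then have F: "mset (filter ?Q ys) = mset P1" and F2: "mset (filter (\<lambda>r. \<not> ?Q r) ys) = mset P2"
    unfolding mset_filter ys(1) P(1) filter_union_mset by (simp_all flip: mset_filter)
  have "length (filter ?Q ys) = length P1" using F by (metis size_mset)
  also have "\<dots> = card H" using list_all2_lengthD[OF P1] by simp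
  finally have len: "length (filter ?Q ys) = card H" .
  note split = sorted_desc_filter_split[OF ys(2), of hi]
  have "take (card H) ys = filter ?Q ys" "drop (card H) ys = filter (\<lambda>r. \<not> ?Q r) ys"
    by (subst split, simp add: len)+
  then show ?thesis using that[of P1] F P1 F2 P(2) by (metis mset_eq_setD)
qed

lemma set_sort_desc_random:
  "set_pmf (sort_desc_random P) = {ys. mset ys = mset P \<and> sorted_wrt (\<lambda>u v. rec_stat v \<le> rec_stat u) ys}"
proof -
  let ?S = "{ys. mset ys = mset P \<and> sorted_wrt (\<lambda>u v. rec_stat v \<le> rec_stat u) ys}"
  have "?S \<subseteq> {ys. set ys \<subseteq> set P \<and> length ys = length P}"
    by (auto dest: mset_eq_setD mset_eq_length)
  then have "finite ?S" by (rule finite_subset) (simp add: finite_lists_length_eq)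
  \<comment> \<open>Sorting by the negated key gives a descending arrangement, so the set of
    admissible orders is non-empty and \<open>pmf_of_set\<close> has the expected support.\<close>
  moreover have "sort_key (\<lambda>r. - rec_stat r) P \<in> ?S"
    using sorted_sort_key[of "\<lambda>r. - rec_stat r" P] by (simp add: sorted_map)
  ultimately show ?thesis unfolding sort_desc_random_def by (subst set_pmf_of_set) blast+
qed

context spaced_signal begin

lemma sorted_path_in_event_A:
  assumes seg: "segment \<Lambda> 1 T H g" and H: "sorted_list_of_set H = map \<eta> [1..<N+1]"
    and len: "length P = T - 1"
    and det: "detects R (c * fT * sqrt (real T)) lo H P" "lo < c * fT * sqrt (real T)"
    and R: "R \<le> \<delta> * real T / 4" "N \<noteq> 0 \<Longrightarrow> R + 1 \<le> C1 * (1 / fT\<^sup>2) * ln (real T)"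
    and lo: "lo \<le> C2 * sqrt (ln (real T))"
    and ys: "mset ys = mset P" "sorted_wrt (\<lambda>u v. rec_stat v \<le> rec_stat u) ys"
  shows "ys \<in> event_A T N \<eta> fT C1 C2 c"
proof -
  have cH: "card H = N"
    using arg_cong[OF H, of length] by simp
  obtain P1 where P1: "mset (take N ys) = mset P1"
    "list_all2 (\<lambda>r h. \<bar>real h - 1 - real (rec_b r)\<bar> \<le> R \<and> c * fT * sqrt (real T) \<le> rec_stat r) P1 (map \<eta> [1..<N+1])"
    and tail: "\<And>r. r \<in> set (drop N ys) \<Longrightarrow> rec_stat r \<le> lo"
    using detects_take_drop[OF det ys] unfolding cH H by blast
  have lP1: "length P1 = N" using list_all2_lengthD[OF P1(2)] by simp
  have at: "\<bar>real (\<eta> (i + 1)) - 1 - real (rec_b (P1 ! i))\<bar> \<le> R" "c * fT * sqrt (real T) \<le> rec_stat (P1 ! i)" if "i < N" for i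
    using list_all2_nthD2[OF P1(2), of i] that by (simp_all add: nth_map del: upt_Suc)
  \<comment> \<open>Change-points are \<open>\<delta> * T\<close> apart and errors are at most a
    quarter of that, so the splits come in the order of their change-points; sorting then pairs the
    \<open>i\<close>-th estimate with the \<open>i\<close>-th change-point.\<close>
  have srt: "sorted (map rec_b P1)"
    unfolding sorted_iff_nth_mono_less
  proof (intro allI impI)
    fix i j assume ij: "i < j" "j < length (map rec_b P1)"
    then have ijN: "i < N" "j < N" using lP1 by auto
    have "sorted_wrt (<) (map \<eta> [1..<N+1])" unfolding H[symmetric] by simp
    then have "\<eta> (i + 1) < \<eta> (j + 1)"
      using sorted_wrt_nth_less[of "(<)" "map \<eta> [1..<N+1]" i j] ij ijN by (simp add: nth_map del: upt_Suc)
    moreover have "set (map \<eta> [1..<N+1]) = H" unfolding H[symmetric] using segment_finite[OF seg] by simp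
    then have "H = \<eta> ` {1..<N+1}" by (simp only: set_map set_upt)
    then have "\<eta> (i + 1) \<in> H" "\<eta> (j + 1) \<in> H" using ijN by auto
    ultimately have "\<delta> * real T \<le> real (\<eta> (j + 1)) - real (\<eta> (i + 1))" using segmentD(8)[OF seg] by blast
    then have "real (rec_b (P1 ! i)) \<le> real (rec_b (P1 ! j))"
      using at(1)[OF ijN(1)] at(1)[OF ijN(2)] R(1) T_large by linarith
    then show "map rec_b P1 ! i \<le> map rec_b P1 ! j" using ijN lP1 by simp
  qed
  have "mset (map rec_b P1) = mset (map rec_b (take N ys))" using P1(1) by simp
  then have bs: "sort (map rec_b (take N ys)) = map rec_b P1"
    using srt by (rule properties_for_sort)
  have "\<bar>real (\<eta> i) - real (sort (map rec_b (take N ys)) ! (i - 1))\<bar> \<le> C1 * (1 / fT\<^sup>2) * ln (real T)"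
    if i: "i \<in> {1..N}" for i
  proof -
    \<comment> \<open>The extra 1 is the offset between \<open>\<eta> i\<close>, the first time of
      the new level, and a split, the last time of the old one.\<close>
    have "\<bar>real (\<eta> i) - 1 - real (rec_b (P1 ! (i - 1)))\<bar> \<le> R" using at(1)[of "i - 1"] i by auto
    moreover have "R + 1 \<le> C1 * (1 / fT\<^sup>2) * ln (real T)" using R(2) i by auto
    moreover have "sort (map rec_b (take N ys)) ! (i - 1) = rec_b (P1 ! (i - 1))"
      unfolding bs using i lP1 by (intro nth_map) auto
    ultimately show ?thesis by linarith
  qed
  moreover have lys: "length ys = T - 1" using ys(1) len by (metis size_mset)
  have lN: "N \<le> length ys" using arg_cong[OF P1(1), of size] lP1 by simp
  have "c * fT * sqrt (real T) \<le> rec_stat (ys ! k)" if "k < N" for k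
  proof -
    have "ys ! k = take N ys ! k" using that by simp
    also have "\<dots> \<in> set (take N ys)" using that lN by (intro nth_mem) simp
    also have "set (take N ys) = set P1" using P1(1) by (rule mset_eq_setD)
    finally obtain i where "i < N" "ys ! k = P1 ! i" using lP1 by (metis in_set_conv_nth)
    then show ?thesis using at(2) by simp
  qed
  moreover have "rec_stat (ys ! k) \<le> C2 * sqrt (ln (real T))" if "N \<le> k" "k < T - 1" for k
  proof -
    have "ys ! k = drop N ys ! (k - N)" using that lys by simp
    also have "\<dots> \<in> set (drop N ys)" using that lys by (intro nth_mem) simp
    finally show ?thesis using tail lo by fastforce
  qed
  ultimately show ?thesis by (simp add: event_A_def Let_def)
qed

lemma prob_wbs2_path_event_A:
  assumes M: "1 \<le> M" and small: "32 * \<Lambda>\<^sub>m < fT * sqrt (\<delta> * real T)"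
    and R: "localization_const \<delta> * \<Lambda>\<^sub>m\<^sup>2 \<le> fT\<^sup>2 * R" "R \<le> \<delta> * real T / 4"
      "N \<noteq> 0 \<Longrightarrow> R + 1 \<le> C1 * (1 / fT\<^sup>2) * ln (real T)"
    and lo: "2 * \<Lambda>\<^sub>m \<le> C2 * sqrt (ln (real T))"
    and seg: "segment \<Lambda> 1 T H g" and H: "sorted_list_of_set H = map \<eta> [1..<N+1]"
    and \<Lambda>: "\<Lambda> * (1 + sqrt (localization_const \<delta>)) ^ N \<le> \<Lambda>\<^sub>m"
  shows "1 - real N * (1 - \<delta>\<^sup>2 / 9) ^ M
    \<le> measure_pmf.prob (wbs2_path x T M) (event_A T N \<eta> fT C1 C2 (sqrt \<delta> / 8))"
proof -
  let ?A = "event_A T N \<eta> fT C1 C2 (sqrt \<delta> / 8)"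
  let ?D = "detects R (sqrt \<delta> / 8 * fT * sqrt (real T)) (2 * \<Lambda>\<^sub>m) H"
  have cH: "card H = N" using arg_cong[OF H, of length] by simp
  define W where "W = fT * sqrt (\<delta> * real T)"
  have "0 < W" using fT T_large by (simp add: W_def)
  moreover have "sqrt \<delta> / 8 * fT * sqrt (real T) = W / 8" by (simp add: W_def real_sqrt_mult)
  ultimately have gap: "2 * \<Lambda>\<^sub>m < sqrt \<delta> / 8 * fT * sqrt (real T)"
    using small unfolding W_def[symmetric] by linarith
  have "measure_pmf.prob (wbs2_path x T M) (- ?A) \<le> real N * (1 - \<delta>\<^sup>2 / 9) ^ M + 0"
    unfolding wbs2_path_def
  proof (rule prob_bind_pmf_le)
    show "measure_pmf.prob (wbs2_rec T x M 1 T) (- {P. ?D P}) \<le> real N * (1 - \<delta>\<^sup>2 / 9) ^ M"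
      using wbs2_rec_detects[OF M small R(1,2) seg, of T] \<Lambda> by (simp add: cH Collect_neg_eq)
    fix P assume P: "P \<in> set_pmf (wbs2_rec T x M 1 T)" "P \<in> {P. ?D P}"
    then have "length P = T - 1" using wbs2_rec_records[OF M P(1)] by auto
    then have "set_pmf (sort_desc_random P) \<subseteq> ?A"
      unfolding set_sort_desc_random using sorted_path_in_event_A[OF seg H _ _ gap R(2,3) lo] P(2) by blast
    then show "measure_pmf.prob (sort_desc_random P) (- ?A) \<le> 0"
      using measure_pmf_zero_iff[of "sort_desc_random P" "- ?A"] by auto
  qed simp
  then show ?thesis
    using measure_pmf.prob_compl[of ?A "wbs2_path x T M"] by (simp add: Compl_eq_Diff_UNIV)
qed

end

section \<open>The noise measure\<close>

lemma prob_space_noise: "0 < \<sigma> \<Longrightarrow> prob_space (noise \<sigma> T)"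
  unfolding noise_def by (intro prob_space_PiM prob_space_normal_density)

lemma sets_event_B: "event_B \<Delta> \<sigma> T \<in> sets (noise \<sigma> T)"
proof -
  have comp: "(\<lambda>\<epsilon>. \<epsilon> i) \<in> borel_measurable (noise \<sigma> T)" if "i \<in> {1..T}" for i
  proof -
    have "(\<lambda>\<epsilon>. \<epsilon> i) \<in> measurable (noise \<sigma> T) (density lborel (normal_density 0 \<sigma>))"
      unfolding noise_def using that by (rule measurable_component_singleton)
    also have "\<dots> = borel_measurable (noise \<sigma> T)" by (intro measurable_cong_sets) auto
    finally show ?thesis .
  qed
  have "event_B \<Delta> \<sigma> T = {\<epsilon> \<in> space (noise \<sigma> T). \<forall>l\<in>{1..T}. \<forall>m\<in>{l..T}.
        \<bar>\<Sum>i = l..m. \<epsilon> i\<bar> / sqrt (real (m - l + 1)) \<le> \<sigma> * sqrt (2 * (1 + \<Delta>) * ln (real T))}"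
    unfolding event_B_def by auto
  also have "\<dots> \<in> sets (noise \<sigma> T)"
  proof (intro sets.sets_Collect_finite_All finite_atLeastAtMost)
    fix l m assume "l \<in> {1..T}" "m \<in> {l..T}"
    then have "(\<lambda>\<epsilon>. \<Sum>i = l..m. \<epsilon> i) \<in> borel_measurable (noise \<sigma> T)"
      by (intro borel_measurable_sum comp) auto
    then show "{\<epsilon> \<in> space (noise \<sigma> T). \<bar>\<Sum>i = l..m. \<epsilon> i\<bar> / sqrt (real (m - l + 1)) \<le> \<sigma> * sqrt (2 * (1 + \<Delta>) * ln (real T))}
       \<in> sets (noise \<sigma> T)" by measurable
  qed
  finally show ?thesis .
qed

text \<open>Over the whole range from 0 to \<open>N + 1\<close> this gives
  \<open>(N + 1) * \<delta> \<le> 1\<close>, which bounds the number of change-points uniformly in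
  \<open>T\<close>.\<close>

lemma change_points_growth:
  fixes \<eta> :: "nat \<Rightarrow> nat"
  assumes inc: "\<forall>i\<le>N. \<eta> i < \<eta> (Suc i)" and gap: "\<forall>i\<in>{1..N+1}. d \<le> real (\<eta> i - \<eta> (i - 1))"
    and "i < j" "j \<le> N + 1" "0 \<le> d"
  shows "real (j - i) * d \<le> real (\<eta> j) - real (\<eta> i)"
  using assms(3,4)
proof (induction j)
  case (Suc j)
  have "d \<le> real (\<eta> (Suc j) - \<eta> j)" using gap Suc.prems by (auto dest: bspec[of _ _ "Suc j"])
  moreover have "\<eta> j < \<eta> (Suc j)" using inc Suc.prems by auto
  ultimately have step: "d \<le> real (\<eta> (Suc j)) - real (\<eta> j)" by (simp add: of_nat_diff)
  show ?case
  proof (cases "i = j")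
    case False
    then have "real (j - i) * d \<le> real (\<eta> j) - real (\<eta> i)" using Suc by auto
    then show ?thesis using step Suc.prems by (simp add: Suc_diff_le algebra_simps)
  qed (use step in simp)
qed simp

lemma eventually_ln_small:
  fixes a \<nu> :: real
  assumes "0 < a" "0 < \<nu>"
  shows "\<forall>\<^sub>F T::nat in sequentially. ln (real T) < \<nu> * real T powr a"
proof -
  have "(\<lambda>T. ln (real T) / real T powr a) \<longlonglongrightarrow> 0" using assms(1) by (rule lim_ln_over_power)
  then have "\<forall>\<^sub>F T in sequentially. ln (real T) / real T powr a < \<nu>"
    using assms(2) by (rule order_tendstoD)
  then show ?thesis using eventually_gt_at_top[of 0]
    by eventually_elim (simp add: pos_divide_less_eq)
qed

text \<open>Start of the recursion: the true signal is its own surrogate and all change-points are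
  undetected. The conventions at \<open>\<eta> 0\<close> and \<open>\<eta> (N + 1)\<close> turn the
  spacing condition into the margins at both ends.\<close>

lemma change_point_segment:
  fixes \<eta> :: "nat \<Rightarrow> nat" and f \<epsilon> :: "nat \<Rightarrow> real"
  assumes sp: "spaced_signal T \<delta> fT"
    and \<eta>: "\<eta> 0 = 1" "\<eta> (N + 1) = T + 1" "\<forall>i\<le>N. \<eta> i < \<eta> (Suc i)"
    and f: "\<forall>t\<in>{2..T}. f t \<noteq> f (t - 1) \<longleftrightarrow> (\<exists>i\<in>{1..N}. t = \<eta> i)"
    and gap: "\<forall>i\<in>{1..N+1}. real (\<eta> i - \<eta> (i - 1)) \<ge> \<delta> * real T"
    and jumps: "\<forall>i\<in>{1..N}. \<bar>f (\<eta> i) - f (\<eta> i - 1)\<bar> \<ge> fT"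
    and "0 \<le> \<tau>" and \<epsilon>: "\<And>l m. 1 \<le> l \<Longrightarrow> l \<le> m \<Longrightarrow> m \<le> T \<Longrightarrow>
        \<bar>\<Sum>i = l..m. \<epsilon> i\<bar> / sqrt (real (m - l + 1)) \<le> \<tau>"
  shows "spaced_signal.segment T \<delta> fT (\<lambda>t. f t + \<epsilon> t) \<tau> 1 T (\<eta> ` {1..N}) f"
    and "sorted_list_of_set (\<eta> ` {1..N}) = map \<eta> [1..<N+1]"
proof -
  interpret spaced_signal T \<delta> fT "\<lambda>t. f t + \<epsilon> t" by (rule sp)
  have d0: "0 \<le> \<delta> * real T" using T_large by linarith
  have sep: "\<delta> * real T \<le> real (\<eta> j) - real (\<eta> i)" if "i < j" "j \<le> N + 1" for i j
  proof -
    have "1 * (\<delta> * real T) \<le> real (j - i) * (\<delta> * real T)"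
      using that d0 by (intro mult_right_mono) auto
    then show ?thesis using change_points_growth[OF \<eta>(3) gap that d0] by linarith
  qed
  have less: "\<eta> i < \<eta> j" if "i < j" "j \<le> N + 1" for i j using sep[OF that] T_large by linarith
  show "segment \<tau> 1 T (\<eta> ` {1..N}) f"
    unfolding segment_def
  proof (intro conjI ballI allI impI)
    show "1 \<le> T" using T_pos by simp
    fix h assume "h \<in> \<eta> ` {1..N}"
    then obtain i where i: "i \<in> {1..N}" "h = \<eta> i" by blast
    show "\<delta> * real T / 2 \<le> real h - real 1" using sep[of 0 i] i \<eta>(1) d0 by simp
    show "\<delta> * real T / 2 \<le> real T + 1 - real h" using sep[of i "N + 1"] i \<eta>(2) d0 by simp
    show "fT \<le> jump f h" using jumps i by (simp add: jump_def)
    fix h' assume "h' \<in> \<eta> ` {1..N}" "h < h'"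
    then obtain j where j: "j \<in> {1..N}" "h' = \<eta> j" by blast
    have "i < j" using \<open>h < h'\<close> less[of j i] i j by (cases i j rule: linorder_cases) auto
    then show "\<delta> * real T \<le> real h' - real h" using sep[of i j] i j by simp
  next
    show "f t = f (t - 1)" if "1 < t" "t \<le> T" "t \<notin> \<eta> ` {1..N}" for t
      using f that by (auto dest!: bspec[of _ _ t])
    show "\<bar>\<Sum>t = l..m. f t + \<epsilon> t - f t\<bar> \<le> \<tau> * sqrt (real (m - l + 1))" if "1 \<le> l" "l \<le> m" "m \<le> T" for l m
      using \<epsilon>[OF that] by (simp add: pos_divide_le_eq)
  qed (use \<open>0 \<le> \<tau>\<close> in auto)
  show "sorted_list_of_set (\<eta> ` {1..N}) = map \<eta> [1..<N+1]"
  proof (rule sorted_distinct_set_unique)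
    have sw: "sorted_wrt (<) (map \<eta> [1..<N+1])"
      using less by (auto simp: sorted_wrt_iff_nth_less simp del: upt_Suc)
    then show "sorted (map \<eta> [1..<N+1])" "distinct (map \<eta> [1..<N+1])"
      by (auto simp: strict_sorted_iff simp del: upt_Suc)
    have "{1..<N+1} = {1..N}" by auto
    then show "set (sorted_list_of_set (\<eta> ` {1..N})) = set (map \<eta> [1..<N+1])" 
      by (simp only: set_map set_upt finite_imageI finite_atLeastAtMost set_sorted_list_of_set)
  qed auto
qed

theorem theorem1:
  fixes \<sigma> \<delta> fbar C \<kappa> :: real
  assumes "\<sigma> > 0" and "\<delta> > 0" and "C > 0" and "\<kappa> > -1/2"
  shows "\<exists>c>0. \<forall>\<Delta>>0. \<exists>C1>0. \<exists>C2>0. \<exists>T0::nat. \<forall>T\<ge>T0.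
    \<forall>(N::nat) (\<eta>::nat \<Rightarrow> nat) (f::nat \<Rightarrow> real) (fT::real) (M::nat).
      \<eta> 0 = 1 \<and> \<eta> (N + 1) = T + 1 \<and> (\<forall>i\<le>N. \<eta> i < \<eta> (Suc i))
      \<and> (\<forall>t\<in>{2..T}. f t \<noteq> f (t - 1) \<longleftrightarrow> (\<exists>i\<in>{1..N}. t = \<eta> i))
      \<and> (\<forall>i\<in>{1..N+1}. real (\<eta> i - \<eta> (i - 1)) \<ge> \<delta> * real T)
      \<and> (\<forall>t\<in>{1..T}. \<bar>f t\<bar> \<le> fbar)
      \<and> (\<forall>i\<in>{1..N}. \<bar>f (\<eta> i) - f (\<eta> i - 1)\<bar> \<ge> fT)
      \<and> fT \<ge> C * real T powr \<kappa>
      \<and> M \<ge> 1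
      \<longrightarrow>
      (\<integral>\<^sup>+ \<epsilon>. ennreal (measure_pmf.prob (wbs2_path (\<lambda>t. f t + \<epsilon> t) T M)
                                   (event_A T N \<eta> fT C1 C2 c)) \<partial>noise \<sigma> T)
      \<ge> ennreal (1 - alpha \<Delta> \<sigma> T
                 - real (N * (N + 1)) / 2 * (2 * C1 * (1 / fT\<^sup>2) * ln (real T) + 1)\<^sup>2
                   * (1 - \<delta>\<^sup>2 / 9) ^ M)"
proof (rule exI[of _ "sqrt \<delta> / 8"], intro conjI allI impI)
  show "0 < sqrt \<delta> / 8" using assms by simp
  fix \<Delta> :: real assume "0 < \<Delta>"
  define \<Gamma> where "\<Gamma> = localization_const \<delta>"
  define \<theta> where "\<theta> = 1 + sqrt \<Gamma>"
  \<comment> \<open>The exponent is a bound for \<open>N\<close>, so the noise level reached after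
    all splits, and with it every constant, does not depend on the number of change-points.\<close>
  define \<tau> where "\<tau> = \<sigma> * sqrt (2 * (1 + \<Delta>)) * \<theta> ^ nat \<lceil>1 / \<delta>\<rceil>"
  \<comment> \<open>Two requirements are met at once: \<open>1024 = 32^2\<close> serves the
    signal-to-noise condition \<open>small\<close>, and \<open>4 * \<Gamma>\<close> serves
    \<open>R \<le> \<delta> * T / 4\<close>.\<close>
  define \<nu> where "\<nu> = C\<^sup>2 * \<delta> / (\<tau>\<^sup>2 * (1024 + 4 * \<Gamma>))"
  have \<Gamma>: "0 < \<Gamma>" using assms by (simp add: \<Gamma>_def localization_const_def)
  have \<theta>: "1 \<le> \<theta>" using \<Gamma> by (simp add: \<theta>_def)
  have \<tau>: "0 < \<tau>" using assms \<open>0 < \<Delta>\<close> \<theta> by (simp add: \<tau>_def)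
  have \<nu>: "0 < \<nu>" using assms \<Gamma> \<tau> by (auto simp: \<nu>_def intro!: divide_pos_pos mult_pos_pos)
  have ge: "\<forall>\<^sub>F T::nat in sequentially. y \<le> real T" for y
    by (rule eventually_sequentiallyI[of "nat \<lceil>y\<rceil>"]) linarith
  have "\<forall>\<^sub>F T::nat in sequentially. 24 / \<delta> \<le> real T \<and> exp (4 * fbar\<^sup>2) \<le> real T \<and> 1 \<le> real T
      \<and> ln (real T) < \<nu> * real T powr (2 * \<kappa> + 1)"
    by (intro eventually_conj eventually_ln_small ge) (use assms \<nu> in auto)
  \<comment> \<open>The exponential condition makes \<open>ln T\<close> at least
    \<open>(2 * fbar)^2\<close>, which pays for the offset 1 in \<open>R3\<close>; the last one
    holds eventually because \<open>2 * \<kappa> + 1\<close> is positive.\<close>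
  then obtain T0 where T0: "\<And>T. T \<ge> T0 \<Longrightarrow> 24 / \<delta> \<le> real T \<and> exp (4 * fbar\<^sup>2) \<le> real T \<and> 1 \<le> real T
      \<and> ln (real T) < \<nu> * real T powr (2 * \<kappa> + 1)"
    unfolding eventually_sequentially by blast
  show "\<exists>C1>0. \<exists>C2>0. \<exists>T0::nat. \<forall>T\<ge>T0.
    \<forall>(N::nat) (\<eta>::nat \<Rightarrow> nat) (f::nat \<Rightarrow> real) (fT::real) (M::nat).
      \<eta> 0 = 1 \<and> \<eta> (N + 1) = T + 1 \<and> (\<forall>i\<le>N. \<eta> i < \<eta> (Suc i))
      \<and> (\<forall>t\<in>{2..T}. f t \<noteq> f (t - 1) \<longleftrightarrow> (\<exists>i\<in>{1..N}. t = \<eta> i))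
      \<and> (\<forall>i\<in>{1..N+1}. real (\<eta> i - \<eta> (i - 1)) \<ge> \<delta> * real T)
      \<and> (\<forall>t\<in>{1..T}. \<bar>f t\<bar> \<le> fbar)
      \<and> (\<forall>i\<in>{1..N}. \<bar>f (\<eta> i) - f (\<eta> i - 1)\<bar> \<ge> fT)
      \<and> fT \<ge> C * real T powr \<kappa>
      \<and> M \<ge> 1
      \<longrightarrow>
      (\<integral>\<^sup>+ \<epsilon>. ennreal (measure_pmf.prob (wbs2_path (\<lambda>t. f t + \<epsilon> t) T M)
                                   (event_A T N \<eta> fT C1 C2 (sqrt \<delta> / 8))) \<partial>noise \<sigma> T)
      \<ge> ennreal (1 - alpha \<Delta> \<sigma> T
                 - real (N * (N + 1)) / 2 * (2 * C1 * (1 / fT\<^sup>2) * ln (real T) + 1)\<^sup>2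
                   * (1 - \<delta>\<^sup>2 / 9) ^ M)"
  \<comment> \<open>In the first witness \<open>\<Gamma> * \<tau>\<^sup>2\<close> comes from the
    radius \<open>R\<close> and the 1 from the offset between a change-point and its split; the
    second is the bound \<open>2 * \<Lambda>\<^sub>m\<close> on CUSUMs free of
    change-points.\<close>
  proof (rule exI[of _ "\<Gamma> * \<tau>\<^sup>2 + 1"], rule conjI, use \<Gamma> in \<open>simp add: add_pos_nonneg add_nonneg_pos\<close>,
      rule exI[of _ "2 * \<tau>"], rule conjI, use \<tau> in simp, rule exI[of _ T0],
      intro allI impI, elim conjE)
    fix T N :: nat and \<eta> :: "nat \<Rightarrow> nat" and f :: "nat \<Rightarrow> real" and fT :: real and M :: nat
    assume TT0: "T0 \<le> T" and \<eta>: "\<eta> 0 = 1" "\<eta> (N + 1) = T + 1" "\<forall>i\<le>N. \<eta> i < \<eta> (Suc i)"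
      and f: "\<forall>t\<in>{2..T}. (f t \<noteq> f (t - 1)) = (\<exists>i\<in>{1..N}. t = \<eta> i)"
      and gap: "\<forall>i\<in>{1..N+1}. \<delta> * real T \<le> real (\<eta> i - \<eta> (i - 1))"
      and fb: "\<forall>t\<in>{1..T}. \<bar>f t\<bar> \<le> fbar"
      and jumps: "\<forall>i\<in>{1..N}. fT \<le> \<bar>f (\<eta> i) - f (\<eta> i - 1)\<bar>"
      and fTge: "C * real T powr \<kappa> \<le> fT" and M: "1 \<le> M"
    note T = T0[OF TT0]
    have lnT: "0 \<le> ln (real T)" using T by simp
    have T1: "0 < real T" using T by linarith
    have dT: "24 \<le> \<delta> * real T" using T assms by (simp add: pos_divide_le_eq mult.commute)
    have fT: "0 < fT" using fTge assms T1 by (smt (verit) mult_pos_pos powr_gt_zero)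
    have "real (N + 1 - 0) * (\<delta> * real T) \<le> real (\<eta> (N + 1)) - real (\<eta> 0)"
      by (rule change_points_growth[OF \<eta>(3) gap]) (use dT in auto)
    then have "(real (N + 1) * \<delta>) * real T \<le> 1 * real T" by (simp add: \<eta>(1,2)[simplified] algebra_simps)
    then have N\<delta>: "real (N + 1) * \<delta> \<le> 1" using T1 by (simp only: mult_le_cancel_right_pos)
    then have \<delta>1: "\<delta> \<le> 1" using assms by (smt (verit) mult_le_cancel_right1 of_nat_1 of_nat_add of_nat_0_le_iff)
    have "real N \<le> 1 / \<delta>" using N\<delta> assms by (simp add: pos_le_divide_eq algebra_simps)
    then have NJ: "N \<le> nat \<lceil>1 / \<delta>\<rceil>" by linarith
    have sp: "spaced_signal T \<delta> fT" by unfold_locales (use assms \<delta>1 fT dT in auto)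
    define \<Lambda>\<^sub>m where "\<Lambda>\<^sub>m = \<tau> * sqrt (ln (real T))"
    define R where "R = \<Gamma> * \<Lambda>\<^sub>m\<^sup>2 / fT\<^sup>2"
    have \<Lambda>sq: "\<Lambda>\<^sub>m\<^sup>2 = \<tau>\<^sup>2 * ln (real T)" using lnT by (simp add: \<Lambda>\<^sub>m_def power_mult_distrib)
    have "\<tau>\<^sup>2 * (1024 + 4 * \<Gamma>) * ln (real T) < \<tau>\<^sup>2 * (1024 + 4 * \<Gamma>) * (\<nu> * real T powr (2 * \<kappa> + 1))"
      using T \<tau> \<Gamma> by (intro mult_strict_left_mono mult_pos_pos) auto
    also have "\<dots> = \<delta> * (C\<^sup>2 * real T powr (2 * \<kappa> + 1))" using \<tau> \<Gamma> by (simp add: \<nu>_def)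
    also have "real T powr (2 * \<kappa> + 1) = (real T powr \<kappa>)\<^sup>2 * real T"
      using T1 powr_add[of "real T" "\<kappa> + \<kappa>" 1] powr_add[of "real T" \<kappa> \<kappa>]
      by (simp only: power2_eq_square mult_2 powr_one of_nat_0_le_iff)
    also have "\<delta> * (C\<^sup>2 * ((real T powr \<kappa>)\<^sup>2 * real T)) = (C * real T powr \<kappa>)\<^sup>2 * (\<delta> * real T)"
      by (simp add: power_mult_distrib)
    also have "\<dots> \<le> fT\<^sup>2 * (\<delta> * real T)" using fTge assms by (intro mult_right_mono power_mono) auto
    finally have key: "(1024 + 4 * \<Gamma>) * \<Lambda>\<^sub>m\<^sup>2 < fT\<^sup>2 * (\<delta> * real T)" by (simp add: \<Lambda>sq mult_ac)
    have G0: "0 \<le> \<Gamma> * \<Lambda>\<^sub>m\<^sup>2" using \<Gamma> by simp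
    have "(32 * \<Lambda>\<^sub>m)\<^sup>2 < (fT * sqrt (\<delta> * real T))\<^sup>2"
      using key G0 dT by (simp add: power_mult_distrib algebra_simps)
    then have small: "32 * \<Lambda>\<^sub>m < fT * sqrt (\<delta> * real T)"
      using fT dT by (intro power2_less_imp_less[of "32 * \<Lambda>\<^sub>m"]) auto
    have R1: "\<Gamma> * \<Lambda>\<^sub>m\<^sup>2 \<le> fT\<^sup>2 * R" using fT by (simp add: R_def)
    have "4 * (\<Gamma> * \<Lambda>\<^sub>m\<^sup>2) \<le> fT\<^sup>2 * (\<delta> * real T)" using key by (simp add: algebra_simps) (smt (verit) zero_le_power2)
    then have R2: "R \<le> \<delta> * real T / 4" using fT by (simp add: R_def pos_divide_le_eq algebra_simps)
    \<comment> \<open>A change-point forces \<open>fT\<close> to be at most \<open>2 * fbar\<close>,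
      whence \<open>1 \<le> ln T / fT^2\<close>. For \<open>N = 0\<close> nothing bounds
      \<open>fT\<close> from above, but then there is no location to estimate.\<close>
    have R3: "R + 1 \<le> (\<Gamma> * \<tau>\<^sup>2 + 1) * (1 / fT\<^sup>2) * ln (real T)" if "N \<noteq> 0"
    proof -
      have "1 < \<eta> 1" using \<eta>(1,3) by (auto dest: spec[of _ 0])
      moreover have "real (N + 1 - 1) * (\<delta> * real T) \<le> real (\<eta> (N + 1)) - real (\<eta> 1)"
        by (rule change_points_growth[OF \<eta>(3) gap]) (use dT that in auto)
      then have "real (\<eta> 1) < real (\<eta> (N + 1))" using dT that by (smt (verit) add_diff_cancel_right' mult_pos_pos of_nat_0_less_iff bot_nat_0.not_eq_extremum)
      then have "\<eta> 1 \<le> T" using \<eta>(2) by simp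
      ultimately have "\<eta> 1 \<in> {1..T}" "\<eta> 1 - 1 \<in> {1..T}" by auto
      then have "\<bar>f (\<eta> 1)\<bar> \<le> fbar" "\<bar>f (\<eta> 1 - 1)\<bar> \<le> fbar" using fb by blast+
      moreover have "fT \<le> \<bar>f (\<eta> 1) - f (\<eta> 1 - 1)\<bar>" using jumps that by auto
      ultimately have "fT \<le> 2 * fbar" by linarith
      then have "fT\<^sup>2 \<le> (2 * fbar)\<^sup>2" using fT by (intro power_mono) auto
      also have "\<dots> = 4 * fbar\<^sup>2" by (simp add: power_mult_distrib)
      also have "\<dots> \<le> ln (real T)" using T T1 by (simp add: ln_ge_iff)
      finally have "1 \<le> ln (real T) / fT\<^sup>2" using fT by (simp add: pos_le_divide_eq)
      moreover have "(\<Gamma> * \<tau>\<^sup>2 + 1) * (1 / fT\<^sup>2) * ln (real T) = R + ln (real T) / fT\<^sup>2"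
        unfolding R_def \<Lambda>sq by (simp add: add_divide_distrib distrib_right)
      ultimately show ?thesis by simp
    qed
    define q where "q = (1 - \<delta>\<^sup>2 / 9) ^ M"
    define c where "c = 1 - real N * q"
    have q: "0 \<le> q" unfolding q_def using assms \<delta>1 power_le_one[of \<delta> 2] by (intro zero_le_power) simp
    let ?A = "event_A T N \<eta> fT (\<Gamma> * \<tau>\<^sup>2 + 1) (2 * \<tau>) (sqrt \<delta> / 8)"
    have good: "c \<le> measure_pmf.prob (wbs2_path (\<lambda>t. f t + \<epsilon> t) T M) ?A" if \<epsilon>: "\<epsilon> \<in> event_B \<Delta> \<sigma> T" for \<epsilon>
    proof -
      define \<Lambda> where "\<Lambda> = \<sigma> * sqrt (2 * (1 + \<Delta>) * ln (real T))"
      have \<Lambda>: "\<Lambda> = \<sigma> * sqrt (2 * (1 + \<Delta>)) * sqrt (ln (real T))" by (simp add: \<Lambda>_def real_sqrt_mult)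
      have \<Lambda>0: "0 \<le> \<Lambda>" unfolding \<Lambda> using assms \<open>0 < \<Delta>\<close> lnT by simp
      note seg = change_point_segment[OF sp \<eta> f gap jumps \<Lambda>0, of \<epsilon>]
      have eb: "\<bar>\<Sum>i = l..m. \<epsilon> i\<bar> / sqrt (real (m - l + 1)) \<le> \<Lambda>" if "1 \<le> l" "l \<le> m" "m \<le> T" for l m
        using \<epsilon> that by (simp add: event_B_def \<Lambda>_def)
      have "\<Lambda> * \<theta> ^ N \<le> \<Lambda> * \<theta> ^ nat \<lceil>1 / \<delta>\<rceil>"
        using \<theta> \<Lambda>0 NJ by (intro mult_left_mono power_increasing) auto
      also have "\<dots> = \<Lambda>\<^sub>m" by (simp add: \<Lambda> \<Lambda>\<^sub>m_def \<tau>_def mult_ac)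
      finally have \<Lambda>N: "\<Lambda> * (1 + sqrt (localization_const \<delta>)) ^ N \<le> \<Lambda>\<^sub>m" by (simp add: \<theta>_def \<Gamma>_def)
      show ?thesis unfolding c_def q_def
        by (rule spaced_signal.prob_wbs2_path_event_A[OF sp M small R1[unfolded \<Gamma>_def] R2 R3 _ seg(1)[OF eb] seg(2)[OF eb] \<Lambda>N])
           (auto simp: \<Lambda>\<^sub>m_def)
    qed
    interpret noise: prob_space "noise \<sigma> T" using assms(1) by (rule prob_space_noise)
    let ?B = "event_B \<Delta> \<sigma> T"
    define K where "K = real (N * (N + 1)) / 2 * (2 * (\<Gamma> * \<tau>\<^sup>2 + 1) * (1 / fT\<^sup>2) * ln (real T) + 1)\<^sup>2"
    \<comment> \<open>The recursion fails with probability at most \<open>N * q\<close>; the claimed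
      prefactor dominates \<open>N\<close>, since its square is at least 1 and \<open>N + 1\<close>
      is at least 2 when \<open>N\<close> is positive.\<close>
    have "real N * 1 \<le> K"
    proof -
      have "real N \<le> real (N * (N + 1)) / 2" by (cases N) (auto simp: field_simps)
      moreover have "0 \<le> 2 * (\<Gamma> * \<tau>\<^sup>2 + 1) * (1 / fT\<^sup>2) * ln (real T)" using \<Gamma> lnT by simp
      then have "1 \<le> (2 * (\<Gamma> * \<tau>\<^sup>2 + 1) * (1 / fT\<^sup>2) * ln (real T) + 1)\<^sup>2" by (intro one_le_power) linarith
      ultimately show ?thesis unfolding K_def by (intro mult_mono) auto
    qed
    then have Kq: "real N * q \<le> K * q" using q by (intro mult_right_mono) auto
    \<comment> \<open>With \<open>c = 1 - N * q\<close> and a probability of \<open>event_B\<close>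
      at most 1, subtracting \<open>N * q\<close> leaves no more than multiplying by
      \<open>c\<close>. The case of negative \<open>c\<close> is separate because
      \<open>ennreal\<close> truncates at 0; there the left side is 0 as well.\<close>
    have "ennreal (1 - alpha \<Delta> \<sigma> T - K * q) \<le> ennreal (measure (noise \<sigma> T) ?B) * ennreal c"
    proof (cases "0 \<le> c")
      case True
      have "measure (noise \<sigma> T) ?B - real N * q \<le> measure (noise \<sigma> T) ?B * c"
        unfolding c_def using q mult_left_le_one_le[of "real N * q" "measure (noise \<sigma> T) ?B"] by (simp add: algebra_simps)
      then have "1 - alpha \<Delta> \<sigma> T - K * q \<le> measure (noise \<sigma> T) ?B * c"
        using Kq by (simp add: alpha_def)
      then show ?thesis using True by (simp add: ennreal_leI flip: ennreal_mult)
    next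
      case False
      have "measure (noise \<sigma> T) ?B \<le> 1" by simp
      then have "1 - alpha \<Delta> \<sigma> T - K * q \<le> 0" using False Kq unfolding alpha_def c_def by linarith
      then show ?thesis by (simp add: ennreal_neg)
    qed
    \<comment> \<open>Only the step function \<open>c\<close> on \<open>event_B\<close> is
      integrated exactly; it lies below the conditional probability pointwise, and monotonicity of
      the nonnegative integral does the rest.\<close>
    also have "\<dots> = (\<integral>\<^sup>+ \<epsilon>. ennreal c * indicator ?B \<epsilon> \<partial>noise \<sigma> T)"
      using sets_event_B[of \<Delta> \<sigma> T] by (simp add: nn_integral_cmult_indicator noise.emeasure_eq_measure mult.commute)
    also have "\<dots> \<le> (\<integral>\<^sup>+ \<epsilon>. ennreal (measure_pmf.prob (wbs2_path (\<lambda>t. f t + \<epsilon> t) T M) ?A) \<partial>noise \<sigma> T)"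
      by (intro nn_integral_mono) (auto simp: indicator_def intro!: ennreal_leI good)
    finally show "ennreal (1 - alpha \<Delta> \<sigma> T
                 - real (N * (N + 1)) / 2 * (2 * (\<Gamma> * \<tau>\<^sup>2 + 1) * (1 / fT\<^sup>2) * ln (real T) + 1)\<^sup>2
                   * (1 - \<delta>\<^sup>2 / 9) ^ M) 
      \<le> (\<integral>\<^sup>+ \<epsilon>. ennreal (measure_pmf.prob (wbs2_path (\<lambda>t. f t + \<epsilon> t) T M) ?A) \<partial>noise \<sigma> T)"
      by (simp only: K_def q_def)
  qed
qed

end
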